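(* Let $n \geq 1$ be an integer and suppose $\mathbb{Z}$ is a three-dimensional real polyhedral Banach space such that its unit sphere $S_{\mathbb{Z}}$ is a right prism having a regular $4n$-gon as its base. Then $z \in S_{\mathbb{Z}}$ is a left-symmetric point in $\mathbb{Z}$ if and only if it is either the centroid of a vertical facet of $S_{\mathbb{Z}}$ or the centroid of a horizontal facet of $S_{\mathbb{Z}}$. Also, $z \in S_{\mathbb{Z}}$ is a right-symmetric point in $\mathbb{Z}$ if and only if it is an extreme point of $B_{\mathbb{Z}}$.
   Context: For a real Banach space $\mathbb{Z}$, $B_{\mathbb{Z}} = \{z \in \mathbb{Z} : \|z\| \leq 1\}$ and $S_{\mathbb{Z}} = \{z \in \mathbb{Z} : \|z\| = 1\}$; $\mathbb{Z}$ is polyhedral if $B_{\mathbb{Z}}$ has only finitely many extreme points. Up to an isomorphism, saying that $S_{\mathbb{Z}}$ is a right prism with a regular $m$-gon as its base ($m$ even; here $m = 4n$) means that $\mathbb{Z} = \mathbb{R}^3$ with the norm whose unit ball $B_{\mathbb{Z}}$ is the convex hull of the vertices $v_{\pm j} = (\cos\frac{2\pi j}{m}, \sin\frac{2\pi j}{m}, \pm 1)$, $j = 0, 1, \dots, m-1$ (for each $j$, $v_{+j}$ and $v_{-j}$ have third coordinate $+1$ and $-1$ respectively). The horizontal facets of $S_{\mathbb{Z}}$ are the two $m$-gonal facets lying in the planes where the third coordinate equals $1$ and $-1$. The vertical facets are the $m$ rectangular facets with vertices $v_{\pm j}, v_{\pm(j+1)}$ (indices $j$ and $j+1$ taken modulo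 $m$). For $x,y \in \mathbb{Z}$, $x$ is Birkhoff-James orthogonal to $y$, written $x \perp_B y$, if $\|x+\lambda y\| \geq \|x\|$ for all $\lambda \in \mathbb{R}$. An element $x \in \mathbb{Z}$ is a left-symmetric point in $\mathbb{Z}$ if for every $y \in \mathbb{Z}$, $x \perp_B y$ implies $y \perp_B x$; it is a right-symmetric point in $\mathbb{Z}$ if for every $y \in \mathbb{Z}$, $y \perp_B x$ implies $x \perp_B y$. *)

theory Defs
  imports "HOL-Analysis.Analysis"
begin

definition birkhoff_orthogonal :: "'a::real_normed_vector \<Rightarrow> 'a \<Rightarrow> bool"  (infix \<open>\<bottom>\<^sub>B\<close> 50)
  where "x \<bottom>\<^sub>B y \<longleftrightarrow> (\<forall>c::real. norm (x + c *\<^sub>R y) \<ge> norm x)"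

definition left_symmetric_point :: "'a::real_normed_vector \<Rightarrow> bool"
  where "left_symmetric_point x \<longleftrightarrow> (\<forall>y. x \<bottom>\<^sub>B y \<longrightarrow> y \<bottom>\<^sub>B x)"

definition right_symmetric_point :: "'a::real_normed_vector \<Rightarrow> bool"
  where "right_symmetric_point x \<longleftrightarrow> (\<forall>y. y \<bottom>\<^sub>B x \<longrightarrow> x \<bottom>\<^sub>B y)"

definition polyhedral_space :: "'a::real_normed_vector itself \<Rightarrow> bool"
  where "polyhedral_space _ \<longleftrightarrow> finite {x. x extreme_point_of cball (0::'a) 1}"

text \<open>The sign \<open>s\<close> is \<open>1\<close> or \<open>-1\<close>. By periodicity
  \<open>prism_vertex m s m = prism_vertex m s 0\<close>, so no reduction of the index modulo \<open>m\<close> is needed.\<close>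

definition prism_vertex :: "nat \<Rightarrow> real \<Rightarrow> nat \<Rightarrow> real^3"
  where "prism_vertex m s j =
    vector [cos (2 * pi * real j / real m), sin (2 * pi * real j / real m), s]"

definition right_prism :: "nat \<Rightarrow> (real^3) set"
  where "right_prism m = convex hull {prism_vertex m s j | s j. s \<in> {1, -1} \<and> j < m}"

definition horizontal_facet :: "nat \<Rightarrow> (real^3) set \<Rightarrow> bool"
  where "horizontal_facet m F \<longleftrightarrow>
    F facet_of right_prism m \<and> (F \<subseteq> {x. x $ 3 = 1} \<or> F \<subseteq> {x. x $ 3 = -1})"

definition vertical_facet :: "nat \<Rightarrow> (real^3) set \<Rightarrow> bool"
  where "vertical_facet m F \<longleftrightarrow>
    F facet_of right_prism m \<and>
    (\<exists>j<m. {x. x extreme_point_of F} =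
      {prism_vertex m 1 j, prism_vertex m (-1) j,
       prism_vertex m 1 (Suc j), prism_vertex m (-1) (Suc j)})"

text \<open>\<open>T\<close> identifies \<open>\<real>\<^sup>3\<close>, normed so that the standard prism is its unit ball,
  isometrically with the space \<open>'a\<close>. It is kept as a parameter because the horizontal and
  vertical facets of the unit sphere of \<open>'a\<close> are the images under \<open>T\<close> of those of the
  standard prism; for the cube (\<open>m = 4\<close>) this distinction is not intrinsic to the norm.\<close>

definition unit_sphere_is_prism :: "nat \<Rightarrow> (real^3 \<Rightarrow> 'a::real_normed_vector) \<Rightarrow> bool"
  where "unit_sphere_is_prism m T \<longleftrightarrow>
    linear T \<and> bij T \<and> cball 0 1 = T ` right_prism m"

text \<open>The centroid of a plane figure \<open>F\<close> is its mean with respect to area. Area is taken in an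
  arbitrary affine parametrisation \<open>u \<mapsto> a + f u\<close> of the plane of \<open>F\<close>; another choice
  multiplies it by a constant, which does not affect the mean.\<close>

definition is_centroid :: "'a::real_vector set \<Rightarrow> 'a \<Rightarrow> bool"
  where "is_centroid F c \<longleftrightarrow>
    (\<exists>(a::'a) (f :: real^2 \<Rightarrow> 'a) K.
       linear f \<and> inj f \<and> compact K \<and> measure lebesgue K > 0 \<and>
       F = (\<lambda>u. a + f u) ` K \<and>
       c = a + f ((1 / measure lebesgue K) *\<^sub>R integral K (\<lambda>u. u)))"

end

(*
  In coordinates the norm is the maximum of finitely many linear functionals: the support
  functions of the 4n vertical facets and plus/minus the height.  Hence x is orthogonal to y iff
  among the functionals attaining the norm at x one is nonnegative and one is nonpositive at y.
  The centroids of the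
  vertical facets are left-symmetric because a quarter turn maps the 4n-gon to itself: the
  vectors orthogonal to such a centroid c are spanned by the axis and by the centroid c' a quarter
  turn away, and the facet functional of c' vanishes at c.  The vertices are right-symmetric because
  a vector on which all three facet functionals at a vertex v are positive attains its norm only on
  functionals that are positive at v.
*)
theory Submission
  imports Defs
begin

section \<open>Birkhoff-James orthogonality in polyhedral norms\<close>

text \<open>The converses rest on explicit witnesses. A unit vector that is no facet centroid
  violates left symmetry against its horizontal part, its vertical part, or the facet centroid a
  quarter turn away. A unit vector that is no vertex violates right symmetry against another unit
  vector on which every functional norming the first one is positive. All computations take place in
  \<open>real^3\<close>; the isomorphism \<open>T\<close> only carries the norm. Centroids are
  defined through integrals over arbitrary parametrisations of a plane, yet no area is computed:
  each facet is point-symmetric, and the mean of a point-symmetric figure is its centre.\<close>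

definition maximizes :: "('b \<Rightarrow> real) set \<Rightarrow> 'b \<Rightarrow> ('b \<Rightarrow> real) \<Rightarrow> bool"
  where "maximizes \<Phi> x f \<longleftrightarrow> f \<in> \<Phi> \<and> (\<forall>g\<in>\<Phi>. g x \<le> f x)"

lemma birkhoff_orthogonal_minus: "x \<bottom>\<^sub>B - y \<longleftrightarrow> x \<bottom>\<^sub>B y"
proof -
  have "x \<bottom>\<^sub>B - z" if "x \<bottom>\<^sub>B z" for z
    unfolding birkhoff_orthogonal_def
  proof
    fix c show "norm x \<le> norm (x + c *\<^sub>R - z)"
      using that[unfolded birkhoff_orthogonal_def, THEN spec, of "- c"] by simp
  qed
  from this[of y] this[of "- y"] show ?thesis by auto
qed

lemma birkhoff_orthogonal_minus_left:
  assumes "x \<bottom>\<^sub>B y" shows "- x \<bottom>\<^sub>B y"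
  unfolding birkhoff_orthogonal_def
proof
  fix c
  have "- x + c *\<^sub>R y = - (x + (- c) *\<^sub>R y)" by simp
  then have "norm (- x + c *\<^sub>R y) = norm (x + (- c) *\<^sub>R y)" by (metis norm_minus_cancel)
  then show "norm (- x) \<le> norm (- x + c *\<^sub>R y)"
    using assms[unfolded birkhoff_orthogonal_def, THEN spec, of "- c"] by simp
qed

locale polyhedral_norm =
  fixes T :: "'b::real_vector \<Rightarrow> 'a::real_normed_vector" and \<Phi> :: "('b \<Rightarrow> real) set"
  assumes T: "linear T"
    and fin: "finite \<Phi>" and ne: "\<Phi> \<noteq> {}"
    and lin: "\<And>f. f \<in> \<Phi> \<Longrightarrow> linear f"
    and unit: "\<And>x. norm (T x) \<le> 1 \<longleftrightarrow> (\<forall>f\<in>\<Phi>. f x \<le> 1)"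
begin

text \<open>Homogeneity turns the description of the unit ball into one of every ball of positive
  radius. Radius 0 is out of reach of scaling, which is why later arguments let a positive radius
  tend to 0.\<close>

lemma norm_le_pos:
  assumes "r > 0"
  shows "norm (T x) \<le> r \<longleftrightarrow> (\<forall>f\<in>\<Phi>. f x \<le> r)"
proof -
  have "norm (T x) \<le> r \<longleftrightarrow> norm (T (x /\<^sub>R r)) \<le> 1"
    using assms by (simp add: linear_scale[OF T] field_simps)
  also have "\<dots> \<longleftrightarrow> (\<forall>f\<in>\<Phi>. f x \<le> r)"
    unfolding unit using assms by (intro ball_cong refl) (simp add: linear_scale[OF lin] field_simps)
  finally show ?thesis .
qed

lemma functional_le_norm:
  assumes "f \<in> \<Phi>" shows "f x \<le> norm (T x)"
proof (rule field_le_epsilon)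
  fix e :: real assume "e > 0"
  then show "f x \<le> norm (T x) + e"
    using norm_le_pos[of "norm (T x) + e" x] assms
    by (simp add: add_nonneg_pos)
qed

lemma ex_maximizes: "\<exists>f. maximizes \<Phi> x f"
proof -
  have "Max ((\<lambda>f. f x) ` \<Phi>) \<in> (\<lambda>f. f x) ` \<Phi>"
    using fin ne by (intro Max_in) auto
  then obtain f where "f \<in> \<Phi>" "f x = Max ((\<lambda>f. f x) ` \<Phi>)" by auto
  then show ?thesis
    unfolding maximizes_def using fin by (metis Max_ge finite_imageI imageI)
qed

lemma maximizes_norm:
  assumes "maximizes \<Phi> x f" shows "norm (T x) = f x"
proof (rule antisym)
  have f: "f \<in> \<Phi>" and g: "\<And>g. g \<in> \<Phi> \<Longrightarrow> g x \<le> f x"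
    using assms by (auto simp: maximizes_def)
  \<comment> \<open>The sign of \<open>f x\<close> is not yet known; \<open>e\<close> keeps the
    radius positive.\<close>
  have le: "norm (T x) \<le> max (f x) e" if "e > 0" for e
    using norm_le_pos[of "max (f x) e" x] g that by (simp add: max.coboundedI1)
  \<comment> \<open>A negative maximum would force \<open>T x\<close> to have norm 0, hence also its
    negative, at which \<open>f\<close> would be positive.\<close>
  have "f x \<ge> 0"
  proof (rule ccontr)
    assume "\<not> f x \<ge> 0"
    have "norm (T x) \<le> 0 + e" if "e > 0" for e
      using le[OF that] \<open>\<not> f x \<ge> 0\<close> that by (simp add: max_def split: if_splits)
    then have "norm (T x) \<le> 0" by (rule field_le_epsilon)
    then have "norm (T (- x)) \<le> 0" by (simp add: linear_neg[OF T])
    then have "f (- x) \<le> 0" using functional_le_norm[OF f, of "- x"] by simp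
    then show False using \<open>\<not> f x \<ge> 0\<close> by (simp add: linear_neg[OF lin[OF f]])
  qed
  then show "norm (T x) \<le> f x"
  proof (cases "f x = 0")
    case True
    then have "norm (T x) \<le> 0 + e" if "e > 0" for e using le[OF that] that by simp
    then have "norm (T x) \<le> 0" by (rule field_le_epsilon)
    then show ?thesis using True by simp
  next
    case False
    with \<open>f x \<ge> 0\<close> show ?thesis using le[of "f x"] by simp
  qed
  show "f x \<le> norm (T x)" by (rule functional_le_norm[OF f])
qed

lemma maximizes_iff: "maximizes \<Phi> x f \<longleftrightarrow> f \<in> \<Phi> \<and> f x = norm (T x)"
proof
  assume "maximizes \<Phi> x f"
  then show "f \<in> \<Phi> \<and> f x = norm (T x)" using maximizes_norm by (simp add: maximizes_def)
qed (simp add: maximizes_def functional_le_norm)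

text \<open>If all maximizing functionals were positive at \<open>y\<close>, a small step from
  \<open>x\<close> along \<open>- y\<close> would lower each of them, while the others stay below
  the norm by continuity. Finiteness of \<open>\<Phi>\<close> gives a common step length, and the
  norm drops.\<close>

lemma orthogonal_imp_maximizes_le:
  assumes "T x \<bottom>\<^sub>B T y"
  shows "\<exists>f. maximizes \<Phi> x f \<and> f y \<le> 0"
proof (rule ccontr)
  assume *: "\<not> ?thesis"
  have "\<forall>\<^sub>F t in at_right 0. f (x - t *\<^sub>R y) < norm (T x)" if f: "f \<in> \<Phi>" for f
  proof (cases "f x = norm (T x)")
    case True
    with * f have "f y > 0" by (force simp: maximizes_iff)
    moreover have "f (x - t *\<^sub>R y) = f x - t * f y" for t
      by (simp add: linear_diff[OF lin[OF f]] linear_scale[OF lin[OF f]])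
    ultimately show ?thesis
      using True by (simp add: eventually_at_filter)
  next
    case False
    then have less: "f x < norm (T x)" using functional_le_norm[OF f, of x] by simp
    have eq: "f (x - t *\<^sub>R y) = f x - t * f y" for t
      by (simp add: linear_diff[OF lin[OF f]] linear_scale[OF lin[OF f]])
    have "((\<lambda>t. f x - t * f y) \<longlongrightarrow> f x - 0 * f y) (at_right 0)"
      by (intro tendsto_intros)
    then show ?thesis
      unfolding eq using less by (intro order_tendstoD(2)) auto
  qed
  then have "\<forall>\<^sub>F t in at_right 0. \<forall>f\<in>\<Phi>. f (x - t *\<^sub>R y) < norm (T x)"
    using fin by (simp add: eventually_ball_finite)
  then obtain t where t: "\<forall>f\<in>\<Phi>. f (x - t *\<^sub>R y) < norm (T x)"
    using eventually_happens'[OF trivial_limit_at_right_real] by blast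
  obtain f where f: "maximizes \<Phi> (x - t *\<^sub>R y) f" using ex_maximizes by blast
  have "norm (T x + (- t) *\<^sub>R T y) = f (x - t *\<^sub>R y)"
    using maximizes_norm[OF f] by (simp add: linear_diff[OF T] linear_scale[OF T])
  also have "\<dots> < norm (T x)" using t f by (auto simp: maximizes_def)
  finally show False using assms unfolding birkhoff_orthogonal_def by (metis not_less)
qed

text \<open>James's criterion in polyhedral form: a maximizer that is nonnegative at
  \<open>y\<close> bounds the norm of \<open>T x + c *\<^sub>R T y\<close> from below for
  \<open>c \<ge> 0\<close>, a nonpositive one does so for \<open>c \<le> 0\<close>. The converse is
  the preceding lemma for \<open>y\<close> and for \<open>- y\<close>.\<close>

lemma orthogonal_iff:
  "T x \<bottom>\<^sub>B T y \<longleftrightarrow>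
    (\<exists>f. maximizes \<Phi> x f \<and> 0 \<le> f y) \<and> (\<exists>f. maximizes \<Phi> x f \<and> f y \<le> 0)"
proof (intro iffI conjI)
  assume *: "T x \<bottom>\<^sub>B T y"
  then show "\<exists>f. maximizes \<Phi> x f \<and> f y \<le> 0" by (rule orthogonal_imp_maximizes_le)
  have "T x \<bottom>\<^sub>B T (- y)" using * by (simp add: linear_neg[OF T] birkhoff_orthogonal_minus)
  then obtain f where f: "maximizes \<Phi> x f" "f (- y) \<le> 0"
    using orthogonal_imp_maximizes_le by blast
  then have "linear f" by (simp add: maximizes_def lin)
  with f show "\<exists>f. maximizes \<Phi> x f \<and> 0 \<le> f y" by (auto simp: linear_neg)
next
  assume "(\<exists>f. maximizes \<Phi> x f \<and> 0 \<le> f y) \<and> (\<exists>f. maximizes \<Phi> x f \<and> f y \<le> 0)"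
  then obtain f g where f: "maximizes \<Phi> x f" "0 \<le> f y" and g: "maximizes \<Phi> x g" "g y \<le> 0"
    by blast
  show "T x \<bottom>\<^sub>B T y" unfolding birkhoff_orthogonal_def
  proof
    fix c
    have key: "norm (T x) \<le> norm (T x + c *\<^sub>R T y)" if h: "maximizes \<Phi> x h" "0 \<le> c * h y" for h
    proof -
      have l: "linear h" "h \<in> \<Phi>" using h lin by (auto simp: maximizes_def)
      have "norm (T x) \<le> h (x + c *\<^sub>R y)"
        using h by (simp add: maximizes_norm linear_add[OF l(1)] linear_scale[OF l(1)])
      also have "\<dots> \<le> norm (T (x + c *\<^sub>R y))" by (rule functional_le_norm[OF l(2)])
      finally show ?thesis by (simp add: linear_add[OF T] linear_scale[OF T])
    qed
    show "norm (T x) \<le> norm (T x + c *\<^sub>R T y)"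
      using key[of f] key[of g] f g by (cases "c \<ge> 0") (auto simp: mult_nonpos_nonpos)
  qed
qed

end

section \<open>Centroids of point-symmetric plane figures\<close>

text \<open>The reflection in \<open>p\<close> preserves both \<open>K\<close> and Lebesgue measure,
  so the integral of \<open>u\<close> equals the integral of
  \<open>2 *\<^sub>R p - u\<close>.\<close>

lemma integral_point_symmetric:
  fixes K :: "'a::euclidean_space set"
  assumes K: "compact K" and sym: "\<And>u. u \<in> K \<Longrightarrow> 2 *\<^sub>R p - u \<in> K"
  shows "integral K (\<lambda>u. u) = measure lebesgue K *\<^sub>R p"
proof -
  have Klm: "K \<in> lmeasurable" by (rule lmeasurable_compact[OF K])
  obtain r where r0: "\<And>u. u \<in> K \<Longrightarrow> dist p u \<le> r"
    using compact_imp_bounded[OF K] bounded_any_center[of K p] by blast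
  have r: "norm (u - p) \<le> r" if "u \<in> K" for u
    using r0[OF that] by (metis dist_commute dist_norm)
  \<comment> \<open>A box centred at \<open>p\<close> is mapped to itself by the reflection, so the
    change of variables, stated for boxes, returns to the same domain.\<close>
  define A where "A = (\<Sum>i\<in>Basis. r *\<^sub>R i :: 'a)"
  have sub: "K \<subseteq> cbox (p - A) (p + A)"
  proof
    fix u assume "u \<in> K"
    have "\<bar>(u - p) \<bullet> i\<bar> \<le> r" if "i \<in> Basis" for i
      using r[OF \<open>u \<in> K\<close>] Basis_le_norm[OF that, of "u - p"] by linarith
    then have "\<bar>u \<bullet> i - p \<bullet> i\<bar> \<le> r" if "i \<in> Basis" for i
      using that by (simp add: inner_diff_left)
    then show "u \<in> cbox (p - A) (p + A)"
      unfolding mem_box A_def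
      by (force simp: inner_diff_left inner_add_left abs_le_iff)
  qed
  have memsym: "2 *\<^sub>R p - u \<in> K \<longleftrightarrow> u \<in> K" for u
    using sym[of u] sym[of "2 *\<^sub>R p - u"] by auto
  have int: "(\<lambda>u. u) integrable_on K"
  proof -
    have "set_integrable lborel K (\<lambda>u. u)"
      unfolding set_integrable_def by (rule borel_integrable_compact[OF K]) (intro continuous_intros)
    then show ?thesis by (rule set_borel_integral_eq_integral(1))
  qed
  let ?g = "\<lambda>u. if u \<in> K then u else 0"
  let ?B = "cbox (p - A) (p + A)"
  have "((\<lambda>u. u) has_integral integral K (\<lambda>u. u)) K" using int by (rule integrable_integral)
  then have h1: "(?g has_integral integral K (\<lambda>u. u)) ?B"
    by (subst has_integral_restrict[OF sub])
  have "((\<lambda>u. ?g ((-1) *\<^sub>R u + 2 *\<^sub>R p)) has_integral integral K (\<lambda>u. u))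
      ((\<lambda>u. (1 / (-1)) *\<^sub>R u + - ((1 / (-1)) *\<^sub>R (2 *\<^sub>R p))) ` ?B)"
    using has_integral_affinity[OF h1, of "-1" "2 *\<^sub>R p"] by simp
  moreover have "(\<lambda>u. (1 / (-1)) *\<^sub>R u + - ((1 / (-1)) *\<^sub>R (2 *\<^sub>R p))) ` ?B = ?B"
  proof -
    have "u \<in> ?B \<Longrightarrow> 2 *\<^sub>R p - u \<in> ?B" for u
      unfolding mem_box by (force simp: inner_diff_left inner_add_left)
    moreover have "u = 2 *\<^sub>R p - (2 *\<^sub>R p - u)" for u by simp
    ultimately have "(\<lambda>u. 2 *\<^sub>R p - u) ` ?B = ?B" by blast
    then show ?thesis by (simp add: image_def)
  qed
  ultimately have "((\<lambda>u. ?g (2 *\<^sub>R p - u)) has_integral integral K (\<lambda>u. u)) ?B"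
    by (simp cong del: if_weak_cong)
  then have "((\<lambda>u. if u \<in> K then 2 *\<^sub>R p - u else 0) has_integral integral K (\<lambda>u. u)) ?B"
    by (simp add: memsym)
  then have h2: "((\<lambda>u. 2 *\<^sub>R p - u) has_integral integral K (\<lambda>u. u)) K"
    by (subst (asm) has_integral_restrict[OF sub])
  have "((\<lambda>u. 1 :: real) has_integral measure lebesgue K) K"
    using Klm by (simp add: has_integral_measure_lborel measure_completion lmeasure_integral integrable_on_const integrable_integral lmeasurable_iff_integrable_on)
  then have "((\<lambda>u. 1 *\<^sub>R (2 *\<^sub>R p)) has_integral measure lebesgue K *\<^sub>R (2 *\<^sub>R p)) K"
    by (rule has_integral_scaleR_left)
  then have h3: "((\<lambda>u. 2 *\<^sub>R p - u) has_integral measure lebesgue K *\<^sub>R (2 *\<^sub>R p) - integral K (\<lambda>u. u)) K"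
    using has_integral_diff[OF _ integrable_integral[OF int]] by simp
  have "integral K (\<lambda>u. u) = measure lebesgue K *\<^sub>R (2 *\<^sub>R p) - integral K (\<lambda>u. u)"
    by (rule has_integral_unique[OF h2 h3])
  then have "2 *\<^sub>R integral K (\<lambda>u. u) = 2 *\<^sub>R (measure lebesgue K *\<^sub>R p)"
    by (simp only: scaleR_2 eq_diff_eq scaleR_add_right)
  then show ?thesis by (simp only: scaleR_cancel_left) simp
qed

text \<open>The symmetry pulls back along the injective parametrisation to a symmetry of
  \<open>K\<close> about the parameter \<open>q\<close> of \<open>p\<close>, whatever
  parametrisation was chosen.\<close>

lemma is_centroid_point_symmetric:
  assumes F: "is_centroid F c" and sym: "\<And>x. x \<in> F \<Longrightarrow> 2 *\<^sub>R p - x \<in> F" and p: "p \<in> F"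
  shows "c = p"
proof -
  from F obtain a and f :: "real^2 \<Rightarrow> 'a" and K where f: "linear f" "inj f" and K: "compact K"
    and pos: "measure lebesgue K > 0" and FK: "F = (\<lambda>u. a + f u) ` K"
    and c: "c = a + f ((1 / measure lebesgue K) *\<^sub>R integral K (\<lambda>u. u))"
    unfolding is_centroid_def by blast
  obtain q where q: "q \<in> K" "p = a + f q" using p FK by auto
  have "2 *\<^sub>R q - u \<in> K" if "u \<in> K" for u
  proof -
    have "2 *\<^sub>R p - (a + f u) \<in> F" using sym that FK by blast
    then obtain v where v: "v \<in> K" "2 *\<^sub>R p - (a + f u) = a + f v" using FK by auto
    have "2 *\<^sub>R f q - f u = f v"
      using v(2) q(2) by (simp add: scaleR_2 algebra_simps)
    then have "f (2 *\<^sub>R q - u) = f v"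
      by (simp only: linear_diff[OF f(1)] linear_scale[OF f(1)])
    then show ?thesis using f(2) v(1) by (simp add: inj_eq)
  qed
  then have "integral K (\<lambda>u. u) = measure lebesgue K *\<^sub>R q"
    by (rule integral_point_symmetric[OF K])
  then show ?thesis using c q pos by simp
qed

section \<open>Centroids under linear maps and their existence in the plane\<close>

lemma is_centroid_injective_image:
  fixes T :: "'a::real_vector \<Rightarrow> 'b::real_vector"
  assumes T: "linear T" "inj T" and F: "is_centroid F c"
  shows "is_centroid (T ` F) (T c)"
proof -
  from F obtain a and f :: "real^2 \<Rightarrow> 'a" and K where f: "linear f" "inj f" and K: "compact K"
    and pos: "measure lebesgue K > 0" and FK: "F = (\<lambda>u. a + f u) ` K"
    and c: "c = a + f ((1 / measure lebesgue K) *\<^sub>R integral K (\<lambda>u. u))"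
    unfolding is_centroid_def by blast
  show ?thesis unfolding is_centroid_def
    using f K pos FK c T
    by (intro exI[of _ "T a"] exI[of _ "T \<circ> f"] exI[of _ K])
      (auto simp: linear_compose inj_compose linear_add image_image)
qed

lemma linear_inv:
  assumes T: "linear T" "bij T"
  shows "linear (inv T)"
proof (rule linearI)
  fix x y c
  have s: "T (inv T v) = v" for v using T(2) by (simp add: bij_is_surj surj_f_inv_f)
  have i: "inv T (T v) = v" for v using T(2) by (simp add: bij_is_inj)
  show "inv T (x + y) = inv T x + inv T y"
    using i[of "inv T x + inv T y"] by (simp add: linear_add[OF T(1)] s)
  show "inv T (c *\<^sub>R x) = c *\<^sub>R inv T x"
    using i[of "c *\<^sub>R inv T x"] by (simp add: linear_scale[OF T(1)] s)
qed

text \<open>Reduces centroids of facets of the unit sphere to those of the standard prism.\<close>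

lemma is_centroid_linear_image:
  assumes T: "linear T" "bij T"
  shows "is_centroid (T ` F) (T c) \<longleftrightarrow> is_centroid F c"
proof
  assume "is_centroid (T ` F) (T c)"
  then have "is_centroid (inv T ` T ` F) (inv T (T c))"
    by (rule is_centroid_injective_image[rotated 2])
      (use T in \<open>auto intro: linear_inv bij_is_inj bij_imp_bij_inv\<close>)
  moreover have "inv T ` T ` F = F" "inv T (T c) = c"
    using T(2) by (simp_all add: bij_is_inj image_inv_f_f)
  ultimately show "is_centroid F c" by simp
qed (use T in \<open>auto intro: is_centroid_injective_image bij_is_inj\<close>)

text \<open>The parameter set of \<open>F\<close> is compact because an injective linear map is
  bounded below, and the disc around the origin gives it full dimension and positive measure. So
  some centroid exists, and symmetry identifies it with \<open>p\<close>.\<close>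

lemma
  fixes f :: "real^2 \<Rightarrow> 'a::euclidean_space"
  assumes f: "linear f" "inj f" and F: "compact F" "F \<subseteq> range (\<lambda>u. p + f u)"
    and r: "r > 0" "\<And>u. norm u \<le> r \<Longrightarrow> p + f u \<in> F"
  shows aff_dim_planar: "aff_dim F = 2"
    and is_centroid_centre: "(\<And>x. x \<in> F \<Longrightarrow> 2 *\<^sub>R p - x \<in> F) \<Longrightarrow> is_centroid F p"
proof -
  define K where "K = {u. p + f u \<in> F}"
  have FK: "F = (\<lambda>u. p + f u) ` K" using F(2) by (auto simp: K_def)
  have "closed K" unfolding K_def
    using continuous_closed_vimage[OF compact_imp_closed[OF F(1)], of "\<lambda>u. p + f u"] linear_continuous_at[OF linear_conv_bounded_linear[THEN iffD1, OF f(1)]]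
    by (auto simp: vimage_def intro!: continuous_intros)
  moreover have "bounded K"
  proof -
    obtain B where B: "B > 0" "\<And>u. B * norm u \<le> norm (f u)"
      using linear_inj_bounded_below_pos[OF f] by blast
    obtain M where M: "\<And>x. x \<in> F \<Longrightarrow> norm x \<le> M"
      using compact_imp_bounded[OF F(1)] by (auto simp: bounded_iff)
    have "norm u \<le> (M + norm p) / B" if "u \<in> K" for u
    proof -
      have "norm (f u) \<le> M + norm p"
        using M[of "p + f u"] that norm_triangle_ineq4[of "p + f u" p] by (simp add: K_def)
      then show ?thesis using B(1) B(2)[of u] by (simp add: field_simps)
    qed
    then show ?thesis by (auto simp: bounded_iff)
  qed
  ultimately have K: "compact K" by (simp add: compact_eq_bounded_closed)
  have ball: "ball 0 r \<subseteq> K" using r(2) by (auto simp: K_def)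
  have "aff_dim (ball 0 r :: (real^2) set) \<le> aff_dim K" by (rule aff_dim_subset[OF ball])
  moreover have "aff_dim (ball 0 r :: (real^2) set) = 2"
    using aff_dim_open[of "ball 0 r :: (real^2) set"] r(1) by simp
  moreover have "aff_dim K \<le> 2" using aff_dim_le_DIM[of K] by simp
  moreover have "aff_dim F = aff_dim K"
    using aff_dim_translation_eq[of p "f ` K"] f by (simp add: FK image_image)
  ultimately show "aff_dim F = 2" by simp
  assume sym: "\<And>x. x \<in> F \<Longrightarrow> 2 *\<^sub>R p - x \<in> F"
  have "\<not> negligible K"
    using open_not_negligible[of "ball 0 r :: (real^2) set"] r(1) negligible_subset[OF _ ball] by auto
  then have "measure lebesgue K > 0"
    using negligible_iff_measure0[OF lmeasurable_compact[OF K]] by (simp add: less_le)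
  then have "is_centroid F (p + f ((1 / measure lebesgue K) *\<^sub>R integral K (\<lambda>u. u)))"
    unfolding is_centroid_def using f K FK by blast
  moreover have "p \<in> F" using r(2)[of 0] r(1) by (simp add: linear_0[OF f(1)])
  ultimately show "is_centroid F p" using is_centroid_point_symmetric[OF _ sym] by metis
qed

section \<open>The prism as an intersection of half-spaces\<close>

definition cylinder_point :: "real \<Rightarrow> real \<Rightarrow> real^3"
  where "cylinder_point t s = vector [cos t, sin t, s]"

text \<open>The inner product with the horizontal unit vector at angle \<open>t\<close>.\<close>

definition radial :: "real \<Rightarrow> real^3 \<Rightarrow> real"
  where "radial t x = cos t * x $ 1 + sin t * x $ 2"

lemma cylinder_point_nth [simp]: "cylinder_point t s $ 1 = cos t" "cylinder_point t s $ 2 = sin t" "cylinder_point t s $ 3 = s"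
  by (simp_all add: cylinder_point_def)

lemma vec3_eq_iff: "(x :: real^3) = y \<longleftrightarrow> x $ 1 = y $ 1 \<and> x $ 2 = y $ 2 \<and> x $ 3 = y $ 3"
  by (simp add: vec_eq_iff forall_3)

lemma radial_cylinder_point [simp]: "radial t (cylinder_point u s) = cos (t - u)"
  by (simp add: radial_def cos_diff)

lemma linear_radial: "linear (radial t)"
  by (rule linearI) (simp_all add: radial_def algebra_simps)

text \<open>The unit vector at angle \<open>t\<close> expanded in the orthonormal frame at angles
  \<open>u\<close> and \<open>u + pi / 2\<close>.\<close>

lemma radial_rotate: "radial t x = cos (t - u) * radial u x + sin (t - u) * radial (u + pi / 2) x"
proof -
  have *: "cos t = cos (t - u) * cos u - sin (t - u) * sin u"
    "sin t = cos (t - u) * sin u + sin (t - u) * cos u"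
    using cos_add[of "t - u" u] sin_add[of "t - u" u] by simp_all
  then show ?thesis
    unfolding radial_def * by (simp add: cos_add sin_add algebra_simps)
qed

lemma planar_coordinates:
  "x $ 1 = radial u x * cos u - radial (u + pi / 2) x * sin u"
  "x $ 2 = radial u x * sin u + radial (u + pi / 2) x * cos u"
  using radial_rotate[of 0 x u] radial_rotate[of "pi / 2" x u]
  by (simp_all add: radial_def sin_diff cos_diff cos_add sin_add mult.commute)

lemma cos_sin_add_multiple_2pi:
  "cos (t + 2 * pi * of_int q) = cos t" "sin (t + 2 * pi * of_int q) = sin t"
  using sin_cos_eq_iff[of "t + 2 * pi * of_int q" t] by (auto simp: mult.commute)

text \<open>With its sine companion this writes the direction \<open>t\<close> as a combination of
  the directions \<open>t - b\<close> and \<open>t + a\<close>. It yields the coordinates of a point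
  in the cone over an edge, and later the positivity of a facet functional at a vertex.\<close>

lemma sin_add_mult_cos: "sin (a + b) * cos t = sin a * cos (t - b) + sin b * cos (t + a)" for t :: real
  by (simp add: sin_add cos_add cos_diff algebra_simps)

lemma sin_add_mult_sin: "sin (a + b) * sin t = sin a * sin (t - b) + sin b * sin (t + a)" for t :: real
  by (simp add: sin_add sin_diff algebra_simps)

lemma ex_polar_coordinates: "\<exists>r a. 0 \<le> r \<and> x = r * cos a \<and> y = r * sin a" for x y :: real
proof -
  obtain r a where *: "x = r * cos a" "y = r * sin a" using polar_Ex by blast
  show ?thesis
  proof (cases "r \<ge> 0")
    case False
    then show ?thesis using * by (intro exI[of _ "- r"] exI[of _ "a + pi"]) simp
  qed (use * in blast)
qed

text \<open>The points whose reflection lies in the hull form a convex set that contains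
  \<open>V\<close>.\<close>

lemma convex_hull_point_symmetric:
  assumes V: "\<And>v. v \<in> V \<Longrightarrow> 2 *\<^sub>R p - v \<in> V" and x: "x \<in> convex hull V"
  shows "2 *\<^sub>R p - x \<in> convex hull V"
proof -
  have "convex {x. 2 *\<^sub>R p - x \<in> convex hull V}"
  proof (rule convexI)
    fix x y and u v :: real
    assume *: "x \<in> {x. 2 *\<^sub>R p - x \<in> convex hull V}" "y \<in> {x. 2 *\<^sub>R p - x \<in> convex hull V}"
      "0 \<le> u" "0 \<le> v" "u + v = 1"
    have "u *\<^sub>R (2 *\<^sub>R p - x) + v *\<^sub>R (2 *\<^sub>R p - y) = (u + v) *\<^sub>R (2 *\<^sub>R p) - (u *\<^sub>R x + v *\<^sub>R y)"
      by (simp add: algebra_simps)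
    then have "2 *\<^sub>R p - (u *\<^sub>R x + v *\<^sub>R y) = u *\<^sub>R (2 *\<^sub>R p - x) + v *\<^sub>R (2 *\<^sub>R p - y)"
      using *(5) by simp
    then show "u *\<^sub>R x + v *\<^sub>R y \<in> {x. 2 *\<^sub>R p - x \<in> convex hull V}"
      using * convexD[OF convex_convex_hull[of V]] by simp
  qed
  then have "convex hull V \<subseteq> {x. 2 *\<^sub>R p - x \<in> convex hull V}"
    by (intro hull_minimal) (auto intro: hull_inc V)
  then show ?thesis using x by blast
qed

section \<open>Trigonometry of the regular 4n-gon\<close>

locale even_prism =
  fixes n :: nat
  assumes n: "n \<ge> 1"
begin

text \<open>Half the angle that an edge subtends at the centre: vertices sit at even and facet
  normals at odd multiples of \<open>\<delta>\<close>. Indices are integers, periodic modulo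
  \<open>4 * n\<close>, so that rotations are plain shifts.\<close>

definition \<delta> :: real where "\<delta> = pi / real (4 * n)"

text \<open>Dividing by \<open>cos \<delta>\<close>, the distance of the edges from the axis, makes
  the functional equal to 1 on its facet.\<close>

definition side :: "int \<Rightarrow> real^3 \<Rightarrow> real"
  where "side k x = radial (of_int (2 * k + 1) * \<delta>) x / cos \<delta>"

definition functionals :: "(real^3 \<Rightarrow> real) set"
  where "functionals = range side \<union> {\<lambda>x. x $ 3, \<lambda>x. - x $ 3}"

definition vertex :: "int \<Rightarrow> real \<Rightarrow> real^3"
  where "vertex k s = cylinder_point (of_int (2 * k) * \<delta>) s"

definition side_centre :: "int \<Rightarrow> real^3"
  where "side_centre k = cos \<delta> *\<^sub>R cylinder_point (of_int (2 * k + 1) * \<delta>) 0"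

lemma \<delta>_bounds: "0 < \<delta>" "\<delta> \<le> pi / 4"
  using n by (auto simp: \<delta>_def field_simps)

lemma n_\<delta>: "real n * \<delta> = pi / 4"
  using n by (simp add: \<delta>_def)

lemma sin_cos_\<delta>_pos: "0 < cos \<delta>" "0 < sin \<delta>" "0 < sin (2 * \<delta>)"
  using \<delta>_bounds pi_gt_zero by (auto intro!: cos_gt_zero sin_gt_zero)

lemma linear_side: "linear (side k)"
  by (rule linearI)
    (simp_all add: side_def linear_add[OF linear_radial] linear_scale[OF linear_radial] add_divide_distrib)

lemma linear_functionals: "f \<in> functionals \<Longrightarrow> linear f"
  by (auto simp: functionals_def linear_side intro: linearI)

lemma side_cylinder_point: "side k (cylinder_point t s) = cos (of_int (2 * k + 1) * \<delta> - t) / cos \<delta>"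
  by (simp add: side_def)

lemma side_vertex: "side k (vertex j s) = cos (of_int (2 * (k - j) + 1) * \<delta>) / cos \<delta>"
  by (simp add: vertex_def side_cylinder_point algebra_simps)

lemma vertex_nth3 [simp]: "vertex k s $ 3 = s"
  by (simp add: vertex_def)

lemma vertex_periodic: "vertex (k + int (4 * n) * q) s = vertex k s"
proof -
  have "of_int (2 * (k + int (4 * n) * q)) * \<delta> = of_int (2 * k) * \<delta> + 2 * pi * of_int q"
    using n_\<delta> by (simp add: algebra_simps)
  then show ?thesis
    unfolding vertex_def vec3_eq_iff by (simp add: cos_sin_add_multiple_2pi)
qed

lemma vertex_mod: "vertex (k mod int (4 * n)) s = vertex k s"
  using vertex_periodic[of "k mod int (4 * n)" "k div int (4 * n)" s] by (simp add: add.commute)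

lemma side_periodic: "side (k + int (4 * n) * q) = side k"
proof -
  have "of_int (2 * (k + int (4 * n) * q) + 1) * \<delta> = of_int (2 * k + 1) * \<delta> + 2 * pi * of_int q"
    using n_\<delta> by (simp add: algebra_simps)
  then show ?thesis
    unfolding side_def radial_def by (simp add: cos_sin_add_multiple_2pi)
qed

lemma side_mod: "side (k mod int (4 * n)) = side k"
  using side_periodic[of "k mod int (4 * n)" "k div int (4 * n)"] by (simp add: add.commute)

text \<open>A shift by \<open>2 * n\<close> indices is a half turn; hence the side functionals are
  closed under negation.\<close>

lemma side_opposite: "side (k + int (2 * n)) x = - side k x"
proof -
  have "of_int (2 * (k + int (2 * n)) + 1) * \<delta> = of_int (2 * k + 1) * \<delta> + pi"
    using n_\<delta> by (simp add: algebra_simps)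
  then have "radial (of_int (2 * (k + int (2 * n)) + 1) * \<delta>) x = - radial (of_int (2 * k + 1) * \<delta>) x"
    by (simp add: radial_def)
  then show ?thesis by (simp add: side_def)
qed

lemma prism_vertex_eq: "prism_vertex (4 * n) s j = vertex (int j) s"
  using n by (simp add: prism_vertex_def vertex_def cylinder_point_def \<delta>_def)

lemma right_prism_eq: "right_prism (4 * n) = convex hull {vertex k s | k s. s \<in> {1, -1}}"
proof -
  have "\<exists>j<4 * n. vertex k s = prism_vertex (4 * n) s j" for k s
  proof -
    have "0 \<le> k mod int (4 * n)" "k mod int (4 * n) < int (4 * n)" using n by simp_all
    moreover from this have "vertex k s = prism_vertex (4 * n) s (nat (k mod int (4 * n)))"
      by (simp only: prism_vertex_eq int_nat_eq if_True vertex_mod)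
    ultimately show ?thesis by (meson nat_less_iff)
  qed
  then have "{prism_vertex (4 * n) s j | s j. s \<in> {1, -1} \<and> j < 4 * n} = {vertex k s | k s. s \<in> {1, -1}}"
    by (auto simp: prism_vertex_eq) blast+
  then show ?thesis by (simp add: right_prism_def)
qed

text \<open>Among the odd multiples of \<open>\<delta>\<close>, exactly those congruent to
  \<open>\<delta>\<close> or \<open>- \<delta>\<close> modulo a full turn are nearest to a multiple
  of it. These residues correspond to the two ends of an edge.\<close>

lemma
  shows cos_odd_multiple_le: "cos (of_int (2 * i + 1) * \<delta>) \<le> cos \<delta>"
    and cos_odd_multiple_eq: "cos (of_int (2 * i + 1) * \<delta>) = cos \<delta> \<Longrightarrow>
      i mod int (4 * n) = 0 \<or> i mod int (4 * n) = int (4 * n) - 1"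
proof -
  define r q where "r = i mod int (4 * n)" and "q = i div int (4 * n)"
  have i: "i = r + int (4 * n) * q" by (simp add: r_def q_def)
  have r: "0 \<le> r" "r < int (4 * n)" using n by (auto simp: r_def)
  have "of_int (2 * i + 1) * \<delta> = of_int (2 * r + 1) * \<delta> + 2 * pi * of_int q"
    unfolding i using n_\<delta> by (simp add: algebra_simps)
  then have eq: "cos (of_int (2 * i + 1) * \<delta>) = cos (of_int (2 * r + 1) * \<delta>)"
    by (simp add: cos_sin_add_multiple_2pi)
  \<comment> \<open>Both sines on the right have arguments between 0 and \<open>pi\<close>, so the
    difference is nonnegative and vanishes only at the ends, \<open>r = 0\<close> or
    \<open>r + 1 = 4 * n\<close>.\<close>
  have diff: "cos \<delta> - cos (of_int (2 * r + 1) * \<delta>) = 2 * (sin (of_int (r + 1) * \<delta>) * sin (of_int r * \<delta>))"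
  proof -
    have "cos \<delta> - cos (of_int (2 * r + 1) * \<delta>)
        = cos (of_int (r + 1) * \<delta> - of_int r * \<delta>) - cos (of_int (r + 1) * \<delta> + of_int r * \<delta>)"
      by (simp add: algebra_simps)
    then show ?thesis by (simp only: cos_add cos_diff)
  qed
  have pi: "real (4 * n) * \<delta> = pi" using n_\<delta> by simp
  have le: "of_int l * \<delta> \<le> pi" if "l \<le> int (4 * n)" for l
    using mult_right_mono[of "real_of_int l" "real (4 * n)" \<delta>] that \<delta>_bounds pi by linarith
  have lt: "of_int l * \<delta> < pi" if "l < int (4 * n)" for l
    using mult_strict_right_mono[of "real_of_int l" "real (4 * n)" \<delta>] that \<delta>_bounds pi by linarith
  have "0 \<le> sin (of_int (r + 1) * \<delta>)" "0 \<le> sin (of_int r * \<delta>)"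
    using r \<delta>_bounds by (intro sin_ge_zero le; simp)+
  then show "cos (of_int (2 * i + 1) * \<delta>) \<le> cos \<delta>"
    unfolding eq using diff by (smt (verit) mult_nonneg_nonneg)
  assume "cos (of_int (2 * i + 1) * \<delta>) = cos \<delta>"
  then have "sin (of_int (r + 1) * \<delta>) = 0 \<or> sin (of_int r * \<delta>) = 0"
    using diff eq by simp
  moreover have "0 < sin (of_int (r + 1) * \<delta>)" if "r \<noteq> int (4 * n) - 1"
    using r \<delta>_bounds that by (intro sin_gt_zero lt) auto
  moreover have "0 < sin (of_int r * \<delta>)" if "r \<noteq> 0"
    using r \<delta>_bounds that by (intro sin_gt_zero lt) auto
  ultimately show "i mod int (4 * n) = 0 \<or> i mod int (4 * n) = int (4 * n) - 1"
    unfolding r_def by force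
qed

lemma side_vertex_le: "side k (vertex j s) \<le> 1"
  using cos_odd_multiple_le[of "k - j"] sin_cos_\<delta>_pos(1) by (simp only: side_vertex divide_le_eq_1_pos)

lemma side_vertex_self [simp]: "side k (vertex k s) = 1" "side k (vertex (k + 1) s) = 1"
  using sin_cos_\<delta>_pos by (simp_all add: side_vertex)

lemma side_vertex_eq_1:
  assumes "side k (vertex j s) = 1"
  shows "k mod int (4 * n) = j mod int (4 * n) \<or> (k + 1) mod int (4 * n) = j mod int (4 * n)"
proof -
  have "(k - j) mod int (4 * n) = 0 \<or> (k - j) mod int (4 * n) = int (4 * n) - 1"
    using assms sin_cos_\<delta>_pos by (intro cos_odd_multiple_eq) (simp add: side_vertex field_simps)
  then show ?thesis
  proof
    assume "(k - j) mod int (4 * n) = 0"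
    then show ?thesis using mod_eq_dvd_iff by blast
  next
    assume *: "(k - j) mod int (4 * n) = int (4 * n) - 1"
    have "(k - j + 1) mod int (4 * n) = ((k - j) mod int (4 * n) + 1) mod int (4 * n)"
      by (rule mod_add_left_eq[symmetric])
    also have "\<dots> = 0" by (simp only: *) simp
    finally have "int (4 * n) dvd (k + 1) - j" by (simp add: dvd_eq_mod_eq_0 algebra_simps)
    then show ?thesis by (simp add: mod_eq_dvd_iff)
  qed
qed

text \<open>Side functionals ignore the height, so the coefficients may be read off at height 0 and
  used with vertices of any height \<open>s\<close>.\<close>

lemma side_planar:
  assumes "x $ 1 = \<alpha> * vertex k 0 $ 1 + \<beta> * vertex (k + 1) 0 $ 1"
    and "x $ 2 = \<alpha> * vertex k 0 $ 2 + \<beta> * vertex (k + 1) 0 $ 2"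
  shows "side i x = \<alpha> * side i (vertex k s) + \<beta> * side i (vertex (k + 1) s)"
  using assms by (simp add: side_def radial_def vertex_def algebra_simps add_divide_distrib)

lemma ex_sector:
  obtains k \<alpha> \<beta> where "\<alpha> \<ge> 0" "\<beta> \<ge> 0"
    "x $ 1 = \<alpha> * vertex k 0 $ 1 + \<beta> * vertex (k + 1) 0 $ 1"
    "x $ 2 = \<alpha> * vertex k 0 $ 2 + \<beta> * vertex (k + 1) 0 $ 2"
proof -
  obtain r t where r: "0 \<le> r" and x: "x $ 1 = r * cos t" "x $ 2 = r * sin t"
    using ex_polar_coordinates by blast
  \<comment> \<open>The floor selects the cone between two consecutive vertex rays that contains the
    direction \<open>t\<close>; \<open>b\<close> and \<open>a\<close> are the angles from
    \<open>t\<close> to these rays, and their sines give the coefficients.\<close>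
  define k where "k = \<lfloor>t / (2 * \<delta>)\<rfloor>"
  define b where "b = t - of_int (2 * k) * \<delta>"
  define a where "a = 2 * \<delta> - b"
  have "of_int k \<le> t / (2 * \<delta>)" "t / (2 * \<delta>) \<le> of_int k + 1"
    unfolding k_def by linarith+
  then have ab: "0 \<le> a" "0 \<le> b" "a + b = 2 * \<delta>" "t - b = of_int (2 * k) * \<delta>" "t + a = of_int (2 * (k + 1)) * \<delta>"
    using \<delta>_bounds by (auto simp: a_def b_def field_simps)
  then have "0 \<le> sin a" "0 \<le> sin b"
    using \<delta>_bounds pi_gt_zero by (auto intro!: sin_ge_zero)
  moreover have "sin (2 * \<delta>) * cos t = sin a * vertex k 0 $ 1 + sin b * vertex (k + 1) 0 $ 1"
    "sin (2 * \<delta>) * sin t = sin a * vertex k 0 $ 2 + sin b * vertex (k + 1) 0 $ 2"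
    using sin_add_mult_cos[of a b t] sin_add_mult_sin[of a b t]
    unfolding ab(3-5) by (simp_all add: vertex_def)
  then have "cos t = sin a / sin (2 * \<delta>) * vertex k 0 $ 1 + sin b / sin (2 * \<delta>) * vertex (k + 1) 0 $ 1"
    "sin t = sin a / sin (2 * \<delta>) * vertex k 0 $ 2 + sin b / sin (2 * \<delta>) * vertex (k + 1) 0 $ 2"
    using sin_cos_\<delta>_pos(3) by (simp_all add: divide_simps mult.commute)
  ultimately show ?thesis
    using r sin_cos_\<delta>_pos
    by (intro that[of "r * (sin a / sin (2 * \<delta>))" "r * (sin b / sin (2 * \<delta>))" k])
      (simp_all only: x distrib_left mult.assoc, simp_all)
qed

lemma vertex_in_right_prism: "s \<in> {1, -1} \<Longrightarrow> vertex k s \<in> right_prism (4 * n)"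
  unfolding right_prism_eq by (rule hull_inc) blast

text \<open>One inclusion only has to be checked at the vertices. For the other, \<open>x\<close>
  lies in a horizontal triangle with an edge of the polygon and a point of the axis as corners,
  because the two edge coefficients add up to \<open>side k x\<close>.\<close>

lemma right_prism_iff: "x \<in> right_prism (4 * n) \<longleftrightarrow> (\<forall>f\<in>functionals. f x \<le> 1)"
proof
  have "{x. \<forall>f\<in>functionals. f x \<le> 1} = (\<Inter>f\<in>functionals. {x. f x \<le> 1})" by auto
  moreover have "convex {x. f x \<le> 1}" if "f \<in> functionals" for f
  proof -
    have "linear f" using that by (rule linear_functionals)
    then show ?thesis
      by (auto intro!: convexI convex_bound_le simp: linear_add linear_scale)
  qed
  ultimately have "convex {x. \<forall>f\<in>functionals. f x \<le> 1}" by (simp add: convex_INT)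
  then have "right_prism (4 * n) \<subseteq> {x. \<forall>f\<in>functionals. f x \<le> 1}"
    unfolding right_prism_eq
    by (intro hull_minimal) (auto simp: functionals_def side_vertex_le)
  then show "x \<in> right_prism (4 * n) \<Longrightarrow> \<forall>f\<in>functionals. f x \<le> 1" by blast
next
  assume *: "\<forall>f\<in>functionals. f x \<le> 1"
  define h where "h = x $ 3"
  have h: "-1 \<le> h" "h \<le> 1" using * by (auto simp: functionals_def h_def)
  have conv: "convex (right_prism (4 * n))" by (simp add: right_prism_def)
  have P: "vertex j h \<in> right_prism (4 * n)" for j
  proof -
    have "vertex j h = ((1 + h) / 2) *\<^sub>R vertex j 1 + ((1 - h) / 2) *\<^sub>R vertex j (-1)"
      by (simp add: vec3_eq_iff vertex_def field_simps)
    also have "\<dots> \<in> right_prism (4 * n)"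
      using h vertex_in_right_prism by (intro convexD[OF conv]) (auto simp: field_simps)
    finally show ?thesis .
  qed
  obtain k \<alpha> \<beta> where ab: "\<alpha> \<ge> 0" "\<beta> \<ge> 0"
    and x: "x $ 1 = \<alpha> * vertex k 0 $ 1 + \<beta> * vertex (k + 1) 0 $ 1"
    "x $ 2 = \<alpha> * vertex k 0 $ 2 + \<beta> * vertex (k + 1) 0 $ 2"
    by (rule ex_sector)
  have "side k x = \<alpha> + \<beta>" using side_planar[OF x, of k 0] by simp
  moreover have "side k x \<le> 1" using * by (auto simp: functionals_def)
  ultimately have le: "\<alpha> + \<beta> \<le> 1" by simp
  \<comment> \<open>The axis point at height \<open>h\<close>, obtained inside the prism as the
    midpoint of two opposite points of vertical edges.\<close>
  define z where "z = (1/2) *\<^sub>R vertex k h + (1/2) *\<^sub>R vertex (k + int (2 * n)) h"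
  have z: "z \<in> right_prism (4 * n)"
    unfolding z_def using P by (intro convexD[OF conv]) auto
  have "of_int (2 * (k + int (2 * n))) * \<delta> = of_int (2 * k) * \<delta> + pi"
    using n_\<delta> by (simp add: algebra_simps)
  then have z_eq: "z $ 1 = 0" "z $ 2 = 0" "z $ 3 = h"
    by (simp_all add: z_def vertex_def)
  have "x = \<alpha> *\<^sub>R vertex k h + \<beta> *\<^sub>R vertex (k + 1) h + (1 - \<alpha> - \<beta>) *\<^sub>R z"
    unfolding vec3_eq_iff using x by (simp add: z_eq vertex_def h_def[symmetric] algebra_simps)
  also have "\<dots> \<in> convex hull {vertex k h, vertex (k + 1) h, z}"
    unfolding convex_hull_3 using ab le by fastforce
  also have "\<dots> \<subseteq> right_prism (4 * n)"
    using P z conv by (intro hull_minimal) auto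
  finally show "x \<in> right_prism (4 * n)" .
qed

lemma right_prism_iff':
  "x \<in> right_prism (4 * n) \<longleftrightarrow> (\<forall>k. side k x \<le> 1) \<and> -1 \<le> x $ 3 \<and> x $ 3 \<le> 1"
  by (auto simp: right_prism_iff functionals_def)

lemma polyhedral_norm_prism:
  assumes "unit_sphere_is_prism (4 * n) T"
  shows "polyhedral_norm T functionals"
proof (rule polyhedral_norm.intro)
  have T: "linear T" "bij T" "cball 0 1 = T ` right_prism (4 * n)"
    using assms by (auto simp: unit_sphere_is_prism_def)
  show "linear T" by fact
  have "range side = side ` {0..<int (4 * n)}"
  proof -
    have "side k \<in> side ` {0..<int (4 * n)}" for k
      using n by (intro image_eqI[of _ _ "k mod int (4 * n)"]) (simp_all only: side_mod, auto)
    then show ?thesis by blast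
  qed
  then have "finite (range side)" by (metis finite_atLeastLessThan_int finite_imageI)
  then show "finite functionals" "functionals \<noteq> {}" by (auto simp: functionals_def)
  show "linear f" if "f \<in> functionals" for f
    using that by (rule linear_functionals)
  show "norm (T x) \<le> 1 \<longleftrightarrow> (\<forall>f\<in>functionals. f x \<le> 1)" for x
  proof -
    have "norm (T x) \<le> 1 \<longleftrightarrow> T x \<in> T ` right_prism (4 * n)" unfolding T(3)[symmetric] by simp
    also have "\<dots> \<longleftrightarrow> x \<in> right_prism (4 * n)"
      using T(2) by (simp add: bij_is_inj inj_image_mem_iff)
    finally show ?thesis by (simp add: right_prism_iff)
  qed
qed

end

context even_prism
begin

section \<open>Extreme points and facets\<close>

definition base_centre :: "real \<Rightarrow> real^3"
  where "base_centre s = vector [0, 0, s]"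

definition side_face :: "int \<Rightarrow> (real^3) set"
  where "side_face k = right_prism (4 * n) \<inter> {x. side k x = 1}"

definition base_face :: "real \<Rightarrow> (real^3) set"
  where "base_face s = right_prism (4 * n) \<inter> {x. s * x $ 3 = 1}"

lemma convex_right_prism: "convex (right_prism (4 * n))"
  by (simp add: right_prism_def)

lemma compact_right_prism: "compact (right_prism (4 * n))"
proof -
  have "{prism_vertex (4 * n) s j | s j. s \<in> {1, -1} \<and> j < 4 * n}
      = (\<lambda>(s, j). prism_vertex (4 * n) s j) ` ({1, -1} \<times> {..<4 * n})" by auto
  then show ?thesis unfolding right_prism_def
    by (intro finite_imp_compact_convex_hull) simp
qed

lemma inner_vertex_self: "s \<in> {1, -1} \<Longrightarrow> vertex k s \<bullet> vertex k s = 2"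
  by (auto simp: inner_vec_def sum_3 vertex_def simp flip: power2_eq_square)

text \<open>All vertices lie on a Euclidean sphere around 0 whose ball contains the prism. The
  tangent plane at a vertex therefore supports the prism in that vertex alone.\<close>

lemma extreme_point_vertex:
  assumes s: "s \<in> {1, -1}"
  shows "vertex k s extreme_point_of right_prism (4 * n)"
proof -
  have "right_prism (4 * n) \<subseteq> cball 0 (sqrt 2)"
    unfolding right_prism_eq using inner_vertex_self
    by (intro hull_minimal) (auto simp: norm_eq_sqrt_inner)
  then have le: "x \<bullet> x \<le> 2" if "x \<in> right_prism (4 * n)" for x
    using that by (auto simp: norm_eq_sqrt_inner)
  \<comment> \<open>The right-hand side equals \<open>2 - x \<bullet> x\<close>.\<close>
  have dist: "0 \<le> 4 - 2 * (vertex k s \<bullet> x) - (vertex k s - x) \<bullet> (vertex k s - x)"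
    if "x \<in> right_prism (4 * n)" for x
    using le[OF that] inner_vertex_self[OF s, of k]
    by (simp add: inner_diff_left inner_diff_right inner_commute)
  show ?thesis
  proof (rule extreme_point_of_Int_supporting_hyperplane_le)
    show "vertex k s \<bullet> x \<le> 2" if "x \<in> right_prism (4 * n)" for x
      using dist[OF that] inner_ge_zero[of "vertex k s - x"] by linarith
    have "x = vertex k s" if "x \<in> right_prism (4 * n)" "vertex k s \<bullet> x = 2" for x
    proof -
      have "(vertex k s - x) \<bullet> (vertex k s - x) \<le> 0" using dist[OF that(1)] that(2) by linarith
      then show ?thesis using inner_ge_zero[of "vertex k s - x"] by simp
    qed
    then show "right_prism (4 * n) \<inter> {x. vertex k s \<bullet> x = 2} = {vertex k s}"
      using vertex_in_right_prism[OF s] inner_vertex_self[OF s] by blast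
  qed
qed

lemma extreme_point_right_prism_iff:
  "x extreme_point_of right_prism (4 * n) \<longleftrightarrow> (\<exists>k s. s \<in> {1, -1} \<and> x = vertex k s)"
proof
  assume "x extreme_point_of right_prism (4 * n)"
  then show "\<exists>k s. s \<in> {1, -1} \<and> x = vertex k s"
    unfolding right_prism_eq using extreme_point_of_convex_hull by fastforce
qed (use extreme_point_vertex in blast)

lemma side_eq_inner:
  "side k x = vector [cos (of_int (2 * k + 1) * \<delta>) / cos \<delta>, sin (of_int (2 * k + 1) * \<delta>) / cos \<delta>, 0] \<bullet> x"
  by (simp add: side_def radial_def inner_vec_def sum_3 add_divide_distrib)

lemma side_face_face_of: "side_face k face_of right_prism (4 * n)"
  unfolding side_face_def side_eq_inner
  by (rule face_of_Int_supporting_hyperplane_le[OF convex_right_prism])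
    (metis right_prism_iff' side_eq_inner)

lemma base_face_face_of:
  assumes "s \<in> {1, -1}"
  shows "base_face s face_of right_prism (4 * n)"
proof -
  have eq: "s * x $ 3 = vector [0, 0, s] \<bullet> x" for x :: "real^3"
    by (simp add: inner_vec_def sum_3)
  show ?thesis
    unfolding base_face_def eq
    by (rule face_of_Int_supporting_hyperplane_le[OF convex_right_prism])
      (use assms in \<open>auto simp: right_prism_iff' simp flip: eq\<close>)
qed

lemma compact_faces: "compact (side_face k)" "s \<in> {1, -1} \<Longrightarrow> compact (base_face s)"
  using face_of_imp_compact[OF convex_right_prism compact_right_prism]
    side_face_face_of base_face_face_of by blast+

lemma side_minus: "side k (- x) = - side k x"
  by (rule linear_neg[OF linear_side])

lemma vertex_add_opposite: "2 *\<^sub>R side_centre k - vertex k s = vertex (k + 1) (- s)"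
  "2 *\<^sub>R side_centre k - vertex (k + 1) s = vertex k (- s)"
proof -
  define t where "t = of_int (2 * k + 1) * \<delta>"
  have "of_int (2 * k) * \<delta> = t - \<delta>" "of_int (2 * (k + 1)) * \<delta> = t + \<delta>"
    by (simp_all add: t_def algebra_simps)
  then show "2 *\<^sub>R side_centre k - vertex k s = vertex (k + 1) (- s)"
    "2 *\<^sub>R side_centre k - vertex (k + 1) s = vertex k (- s)"
    unfolding vertex_def side_centre_def t_def[symmetric]
    by (simp_all add: vec3_eq_iff cos_add cos_diff sin_add sin_diff)
qed

section \<open>Orthonormal coordinates and inscribed discs of the facets\<close>

definition side_param :: "int \<Rightarrow> real^2 \<Rightarrow> real^3"
  where "side_param k u = u $ 1 *\<^sub>R cylinder_point (of_int (2 * k + 1) * \<delta> + pi / 2) 0 + u $ 2 *\<^sub>R vector [0, 0, 1]"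

definition base_param :: "real^2 \<Rightarrow> real^3"
  where "base_param u = vector [u $ 1, u $ 2, 0]"

lemma side_param: "linear (side_param k)" "inj (side_param k)"
proof -
  show "linear (side_param k)"
    by (rule linearI) (simp_all add: side_param_def vec3_eq_iff algebra_simps)
  have "radial (of_int (2 * k + 1) * \<delta> + pi / 2) (side_param k u) = u $ 1 \<and> side_param k u $ 3 = u $ 2" for u
    unfolding side_param_def linear_add[OF linear_radial] linear_scale[OF linear_radial]
    by (simp add: radial_def)
  then have "u = v" if "side_param k u = side_param k v" for u v
    unfolding vec_eq_iff forall_2 using that by metis
  then show "inj (side_param k)" by (rule injI)
qed

lemma base_param: "linear base_param" "inj base_param"
proof -
  show "linear base_param"
    by (rule linearI) (simp_all add: base_param_def vec3_eq_iff)
  show "inj base_param"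
    by (intro injI) (simp add: base_param_def vec3_eq_iff vec_eq_iff forall_2)
qed

lemma side_face_subset: "side_face k \<subseteq> range (\<lambda>u. side_centre k + side_param k u)"
proof
  fix x assume "x \<in> side_face k"
  define t where "t = of_int (2 * k + 1) * \<delta>"
  have r: "radial t x = cos \<delta>"
    using \<open>x \<in> side_face k\<close> sin_cos_\<delta>_pos by (simp add: side_face_def side_def t_def)
  have "x = side_centre k + side_param k (vector [radial (t + pi / 2) x, x $ 3])"
    using planar_coordinates[of x t] unfolding r side_centre_def side_param_def t_def[symmetric]
    by (simp add: vec3_eq_iff cos_add sin_add)
  then show "x \<in> range (\<lambda>u. side_centre k + side_param k u)" by blast
qed

text \<open>Edges of the base have length \<open>2 * sin \<delta>\<close> and the prism has height
  2, so a disc of radius \<open>sin \<delta>\<close> around the centre fits into the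
  rectangle.\<close>

lemma side_face_ball:
  assumes u: "norm u \<le> sin \<delta>"
  shows "side_centre k + side_param k u \<in> side_face k"
proof -
  define t where "t = of_int (2 * k + 1) * \<delta>"
  let ?x = "side_centre k + side_param k u"
  have u1: "\<bar>u $ 1\<bar> \<le> sin \<delta>" using u component_le_norm_cart[of u 1] by linarith
  have u2: "\<bar>u $ 2\<bar> \<le> 1" using u component_le_norm_cart[of u 2] sin_le_one[of \<delta>] by linarith
  \<comment> \<open>Barycentric coordinates along the edge, whose ends have tangential coordinates
    \<open>- sin \<delta>\<close> and \<open>sin \<delta>\<close>.\<close>
  define \<alpha> \<beta> where "\<alpha> = (1 - u $ 1 / sin \<delta>) / 2" and "\<beta> = (1 + u $ 1 / sin \<delta>) / 2"
  have ab: "0 \<le> \<alpha>" "0 \<le> \<beta>" "\<alpha> + \<beta> = 1" "(\<beta> - \<alpha>) * sin \<delta> = u $ 1"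
    using u1 sin_cos_\<delta>_pos by (auto simp: \<alpha>_def \<beta>_def field_simps)
  have v: "of_int (2 * k) * \<delta> = t - \<delta>" "of_int (2 * (k + 1)) * \<delta> = t + \<delta>"
    by (simp_all add: t_def algebra_simps)
  have x3: "?x $ 3 = u $ 2" by (simp add: side_centre_def side_param_def)
  have \<alpha>: "\<alpha> = 1 - \<beta>" using ab by simp
  have "?x $ 1 = \<alpha> * vertex k 0 $ 1 + \<beta> * vertex (k + 1) 0 $ 1"
    "?x $ 2 = \<alpha> * vertex k 0 $ 2 + \<beta> * vertex (k + 1) 0 $ 2"
    unfolding vertex_def v side_centre_def side_param_def t_def[symmetric] ab(4)[symmetric]
    by (simp_all add: \<alpha> cos_add cos_diff sin_add sin_diff algebra_simps)
  then have side: "side i ?x = \<alpha> * side i (vertex k 0) + \<beta> * side i (vertex (k + 1) 0)" for i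
    by (rule side_planar)
  have "side i ?x \<le> 1" for i
    unfolding side using ab side_vertex_le by (intro convex_bound_le) auto
  moreover have "side k ?x = 1" unfolding side using ab by simp
  ultimately show ?thesis
    unfolding side_face_def using u2 x3 by (simp add: right_prism_iff' abs_le_iff)
qed

lemma base_face_subset:
  assumes "s \<in> {1, -1}"
  shows "base_face s \<subseteq> range (\<lambda>u. base_centre s + base_param u)"
proof
  fix x assume "x \<in> base_face s"
  then have "s * x $ 3 = 1" by (simp add: base_face_def)
  then have "x = base_centre s + base_param (vector [x $ 1, x $ 2])"
    using assms by (auto simp: vec3_eq_iff base_centre_def base_param_def)
  then show "x \<in> range (\<lambda>u. base_centre s + base_param u)" by blast
qed

text \<open>The polygon has inradius \<open>cos \<delta>\<close>; half of it suffices and lets the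
  two coordinates be estimated separately.\<close>

lemma base_face_ball:
  assumes s: "s \<in> {1, -1}" and u: "norm u \<le> cos \<delta> / 2"
  shows "base_centre s + base_param u \<in> base_face s"
proof -
  let ?x = "base_centre s + base_param u"
  have "side i ?x \<le> 1" for i
  proof -
    let ?t = "of_int (2 * i + 1) * \<delta>"
    have "\<bar>cos ?t * u $ 1\<bar> \<le> \<bar>u $ 1\<bar>" "\<bar>sin ?t * u $ 2\<bar> \<le> \<bar>u $ 2\<bar>"
      unfolding abs_mult by (intro mult_left_le_one_le; simp)+
    then have "cos ?t * u $ 1 \<le> \<bar>u $ 1\<bar>" "sin ?t * u $ 2 \<le> \<bar>u $ 2\<bar>" by linarith+
    moreover have "\<bar>u $ 1\<bar> \<le> cos \<delta> / 2" "\<bar>u $ 2\<bar> \<le> cos \<delta> / 2"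
      using u component_le_norm_cart[of u 1] component_le_norm_cart[of u 2] by linarith+
    ultimately have "radial ?t ?x \<le> cos \<delta>"
      unfolding radial_def base_centre_def base_param_def by simp
    then show ?thesis using sin_cos_\<delta>_pos(1) by (simp add: side_def)
  qed
  moreover have "?x $ 3 = s" by (simp add: base_centre_def base_param_def)
  ultimately show ?thesis
    using s by (auto simp: base_face_def right_prism_iff')
qed

lemma aff_dim_side_face: "aff_dim (side_face k) = 2"
  using aff_dim_planar[OF side_param compact_faces(1) side_face_subset sin_cos_\<delta>_pos(2) side_face_ball] .

lemma aff_dim_base_face:
  assumes s: "s \<in> {1, -1}" shows "aff_dim (base_face s) = 2"
  using aff_dim_planar[OF base_param compact_faces(2)[OF s] base_face_subset[OF s]
      half_gt_zero[OF sin_cos_\<delta>_pos(1)] base_face_ball[OF s]] .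

text \<open>The base face is proper and already two-dimensional, and a proper face of a convex set
  has smaller dimension.\<close>

lemma aff_dim_right_prism: "aff_dim (right_prism (4 * n)) = 3"
proof -
  have "vertex 0 (-1) \<notin> base_face 1" by (simp add: base_face_def)
  then have "base_face 1 \<noteq> right_prism (4 * n)"
    using vertex_in_right_prism[of "-1" 0] by auto
  then have "aff_dim (base_face 1) < aff_dim (right_prism (4 * n))"
    using base_face_face_of[of 1] by (intro face_of_aff_dim_lt convex_right_prism) auto
  then show ?thesis
    using aff_dim_base_face[of 1] aff_dim_le_DIM[of "right_prism (4 * n)"] by simp
qed

section \<open>The facets of the prism and their centroids\<close>

lemma facet_iff: "F facet_of right_prism (4 * n) \<longleftrightarrow> F face_of right_prism (4 * n) \<and> aff_dim F = 2"
  by (auto simp: facet_of_def aff_dim_right_prism)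

text \<open>Reflection in the axis point negates the side functionals, and negation merely permutes
  them.\<close>

lemma base_face_point_symmetric:
  assumes s: "s \<in> {1, -1}" and x: "x \<in> base_face s"
  shows "2 *\<^sub>R base_centre s - x \<in> base_face s"
proof -
  let ?y = "2 *\<^sub>R base_centre s - x"
  have "side i ?y = side (i + int (2 * n)) x" for i
  proof -
    have "radial t ?y = - radial t x" for t by (simp add: radial_def base_centre_def)
    then show ?thesis unfolding side_opposite by (simp add: side_def)
  qed
  then show ?thesis
    using x s by (auto simp: base_face_def right_prism_iff' base_centre_def)
qed

lemma horizontal_facet_iff:
  "horizontal_facet (4 * n) F \<longleftrightarrow> (\<exists>s\<in>{1, -1}. F = base_face s)"
proof
  assume "horizontal_facet (4 * n) F"
  then have F: "F face_of right_prism (4 * n)" "aff_dim F = 2"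
    and "F \<subseteq> {x. x $ 3 = 1} \<or> F \<subseteq> {x. x $ 3 = -1}"
    by (auto simp: horizontal_facet_def facet_iff)
  then have "F \<subseteq> {x. 1 * x $ 3 = 1} \<or> F \<subseteq> {x. (-1) * x $ 3 = 1}" by auto
  then obtain s :: real where s: "s \<in> {1, -1}" "F \<subseteq> {x. s * x $ 3 = 1}" by blast
  then have sub: "F \<subseteq> base_face s"
    using face_of_imp_subset[OF F(1)] by (auto simp: base_face_def)
  have "F face_of base_face s"
    using face_of_subset[OF F(1) sub] by (simp add: base_face_def)
  \<comment> \<open>A proper face of the base face would have dimension less than 2.\<close>
  then have "F = base_face s"
    using face_of_aff_dim_lt[OF face_of_imp_convex[OF base_face_face_of[OF s(1)]], of F]
      F(2) aff_dim_base_face[OF s(1)] by linarith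
  then show "\<exists>s\<in>{1, -1}. F = base_face s" using s(1) by blast
next
  assume "\<exists>s\<in>{1, -1}. F = base_face s"
  then obtain s where s: "s \<in> {1, -1}" "F = base_face s" by blast
  then show "horizontal_facet (4 * n) F"
    using base_face_face_of[OF s(1)] aff_dim_base_face[OF s(1)]
    by (auto simp: horizontal_facet_def facet_iff base_face_def)
qed

lemma horizontal_centroid_iff:
  "(\<exists>F. horizontal_facet (4 * n) F \<and> is_centroid F c) \<longleftrightarrow> (\<exists>s\<in>{1, -1}. c = base_centre s)"
proof -
  have "is_centroid (base_face s) c \<longleftrightarrow> c = base_centre s" if s: "s \<in> {1, -1}" for s
  proof
    have "base_centre s \<in> base_face s"
      using base_face_ball[OF s, of 0] sin_cos_\<delta>_pos linear_0[OF base_param(1)] by simp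
    then show "c = base_centre s" if "is_centroid (base_face s) c"
      using is_centroid_point_symmetric[OF that base_face_point_symmetric[OF s]] by blast
    have "is_centroid (base_face s) (base_centre s)"
      by (rule is_centroid_centre[OF base_param compact_faces(2)[OF s] base_face_subset[OF s]
          half_gt_zero[OF sin_cos_\<delta>_pos(1)] base_face_ball[OF s] base_face_point_symmetric[OF s]])
    then show "c = base_centre s \<Longrightarrow> is_centroid (base_face s) c" by simp
  qed
  then show ?thesis unfolding horizontal_facet_iff by blast
qed

lemma extreme_point_side_face_iff:
  "x extreme_point_of side_face k \<longleftrightarrow> (\<exists>s\<in>{1, -1}. x = vertex k s \<or> x = vertex (k + 1) s)"
proof
  assume "x extreme_point_of side_face k"
  then have "x extreme_point_of right_prism (4 * n)" "side k x = 1"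
    using extreme_point_of_face[OF side_face_face_of] by (auto simp: side_face_def)
  then obtain j s where js: "s \<in> {1, -1}" "x = vertex j s" "side k (vertex j s) = 1"
    by (auto simp: extreme_point_right_prism_iff)
  then have "x = vertex k s \<or> x = vertex (k + 1) s"
    using side_vertex_eq_1[OF js(3)] by (metis vertex_mod)
  then show "\<exists>s\<in>{1, -1}. x = vertex k s \<or> x = vertex (k + 1) s" using js(1) by blast
next
  assume "\<exists>s\<in>{1, -1}. x = vertex k s \<or> x = vertex (k + 1) s"
  then show "x extreme_point_of side_face k"
    unfolding extreme_point_of_face[OF side_face_face_of]
    using extreme_point_vertex vertex_in_right_prism by (auto simp: side_face_def)
qed

text \<open>A compact convex set is the hull of its extreme points, so a face is determined by its
  vertices. This connects the vertex description of vertical facets with the supporting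
  planes.\<close>

lemma face_eq_side_face:
  assumes F: "F face_of right_prism (4 * n)"
    and ext: "\<And>x. x extreme_point_of F \<longleftrightarrow> (\<exists>s\<in>{1, -1}. x = vertex k s \<or> x = vertex (k + 1) s)"
  shows "F = side_face k"
proof -
  have "F = convex hull {x. x extreme_point_of F}"
    using F face_of_imp_compact[OF convex_right_prism compact_right_prism] face_of_imp_convex
    by (intro Krein_Milman_Minkowski) auto
  also have "\<dots> = convex hull {x. x extreme_point_of side_face k}"
    by (simp only: ext extreme_point_side_face_iff)
  also have "\<dots> = side_face k"
    using compact_faces face_of_imp_convex[OF side_face_face_of]
    by (intro Krein_Milman_Minkowski[symmetric]) auto
  finally show ?thesis .
qed

lemma side_face_point_symmetric:
  assumes x: "x \<in> side_face k"
  shows "2 *\<^sub>R side_centre k - x \<in> side_face k"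
proof -
  have eq: "side_face k = convex hull {x. x extreme_point_of side_face k}"
    using compact_faces face_of_imp_convex[OF side_face_face_of] by (intro Krein_Milman_Minkowski) auto
  have "2 *\<^sub>R side_centre k - x \<in> convex hull {x. x extreme_point_of side_face k}"
    using x by (subst (asm) eq) (rule convex_hull_point_symmetric;
      auto simp: extreme_point_side_face_iff vertex_add_opposite)
  then show ?thesis using eq by simp
qed

lemma vertical_facet_iff: "vertical_facet (4 * n) F \<longleftrightarrow> (\<exists>k. F = side_face k)"
proof
  assume "vertical_facet (4 * n) F"
  then obtain j where F: "F face_of right_prism (4 * n)"
    and ext: "{x. x extreme_point_of F} = {vertex (int j) 1, vertex (int j) (-1), vertex (int j + 1) 1, vertex (int j + 1) (-1)}"
    by (auto simp: vertical_facet_def facet_iff prism_vertex_eq add.commute)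
  have "F = side_face (int j)"
    using ext by (intro face_eq_side_face[OF F]) blast
  then show "\<exists>k. F = side_face k" by blast
next
  assume "\<exists>k. F = side_face k"
  then obtain k where k: "F = side_face k" by blast
  define j where "j = nat (k mod int (4 * n))"
  have j: "int j = k mod int (4 * n)" "j < 4 * n" using n by (auto simp: j_def nat_less_iff)
  have F: "F = side_face (int j)" unfolding j(1) k side_face_def side_mod ..
  have "{x. x extreme_point_of F} = {prism_vertex (4 * n) 1 j, prism_vertex (4 * n) (-1) j,
       prism_vertex (4 * n) 1 (Suc j), prism_vertex (4 * n) (-1) (Suc j)}"
    unfolding F by (auto simp: extreme_point_side_face_iff prism_vertex_eq add.commute)
  then show "vertical_facet (4 * n) F"
    unfolding vertical_facet_def facet_iff
    using j(2) side_face_face_of aff_dim_side_face by (auto simp: k)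
qed

lemma vertical_centroid_iff:
  "(\<exists>F. vertical_facet (4 * n) F \<and> is_centroid F c) \<longleftrightarrow> (\<exists>k. c = side_centre k)"
proof -
  have "is_centroid (side_face k) c \<longleftrightarrow> c = side_centre k" for k
  proof
    have "side_centre k \<in> side_face k"
      using side_face_ball[of 0 k] sin_cos_\<delta>_pos linear_0[OF side_param(1)] by simp
    then show "c = side_centre k" if "is_centroid (side_face k) c"
      using is_centroid_point_symmetric[OF that side_face_point_symmetric] by blast
    have "is_centroid (side_face k) (side_centre k)"
      by (rule is_centroid_centre[OF side_param compact_faces(1) side_face_subset sin_cos_\<delta>_pos(2) side_face_ball
            side_face_point_symmetric])
    then show "c = side_centre k \<Longrightarrow> is_centroid (side_face k) c" by simp
  qed
  then show ?thesis unfolding vertical_facet_iff by blast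
qed

end

section \<open>Left- and right-symmetric points\<close>

locale prism_norm = even_prism n for n +
  fixes T :: "real^3 \<Rightarrow> 'a::real_normed_vector"
  assumes prism: "unit_sphere_is_prism (4 * n) T"
begin

sublocale polyhedral_norm T functionals
  by (rule polyhedral_norm_prism[OF prism])

text \<open>Cone coordinates of the horizontal projection; the height stays free.\<close>

definition sector :: "int \<Rightarrow> real \<Rightarrow> real \<Rightarrow> real^3 \<Rightarrow> bool"
  where "sector k \<alpha> \<beta> x \<longleftrightarrow> 0 \<le> \<alpha> \<and> 0 \<le> \<beta> \<and>
    x $ 1 = \<alpha> * vertex k 0 $ 1 + \<beta> * vertex (k + 1) 0 $ 1 \<and>
    x $ 2 = \<alpha> * vertex k 0 $ 2 + \<beta> * vertex (k + 1) 0 $ 2"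

lemma sector_exists: obtains k \<alpha> \<beta> where "sector k \<alpha> \<beta> x"
  using ex_sector[of x] unfolding sector_def by metis

lemma sector_side:
  "sector k \<alpha> \<beta> x \<Longrightarrow> side i x = \<alpha> * side i (vertex k 0) + \<beta> * side i (vertex (k + 1) 0)"
  unfolding sector_def by (intro side_planar) auto

lemma sector_side_self: "sector k \<alpha> \<beta> x \<Longrightarrow> side k x = \<alpha> + \<beta>"
  using sector_side[of k \<alpha> \<beta> x k] by simp

lemma sector_side_le:
  assumes "sector k \<alpha> \<beta> x" shows "side i x \<le> \<alpha> + \<beta>"
proof -
  have "0 \<le> \<alpha>" "0 \<le> \<beta>" using assms by (auto simp: sector_def)
  then show ?thesis
    unfolding sector_side[OF assms]
    using mult_left_mono[OF side_vertex_le[of i k 0], of \<alpha>] mult_left_mono[OF side_vertex_le[of i "k + 1" 0], of \<beta>]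
    by simp
qed

lemma functionals_cases [consumes 1, case_names side up down]:
  assumes "f \<in> functionals"
  obtains i where "f = side i" | "f = (\<lambda>x. x $ 3)" | "f = (\<lambda>x. - x $ 3)"
  using assms by (auto simp: functionals_def)

lemma in_functionals [simp]:
  "side i \<in> functionals" "(\<lambda>x. x $ 3) \<in> functionals" "(\<lambda>x. - x $ 3) \<in> functionals"
  by (auto simp: functionals_def)

lemma scaled_height_in_functionals [simp]: "s \<in> {1, -1} \<Longrightarrow> (\<lambda>x. s * x $ 3) \<in> functionals"
  by (auto simp: functionals_def)

text \<open>Over the cone of an edge, the functional of that edge dominates all other sides.\<close>

lemma norm_sector:
  assumes "sector k \<alpha> \<beta> x" shows "norm (T x) = max (\<alpha> + \<beta>) \<bar>x $ 3\<bar>"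
proof (rule antisym)
  obtain f where f: "f \<in> functionals" "f x = norm (T x)"
    using ex_maximizes[of x] by (auto simp: maximizes_iff)
  from f(1) show "norm (T x) \<le> max (\<alpha> + \<beta>) \<bar>x $ 3\<bar>"
  proof (cases rule: functionals_cases)
    case (side i)
    then show ?thesis using f(2) sector_side_le[OF assms, of i] by simp
  qed (use f(2) in auto)
  show "max (\<alpha> + \<beta>) \<bar>x $ 3\<bar> \<le> norm (T x)"
    using functional_le_norm[of "side k" x] functional_le_norm[of "\<lambda>x. x $ 3" x]
      functional_le_norm[of "\<lambda>x. - x $ 3" x] sector_side_self[OF assms] by auto
qed

lemma norm_eq_1I:
  assumes "f \<in> functionals" "f x = 1" "\<And>i. side i x \<le> 1" "\<bar>x $ 3\<bar> \<le> 1"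
  shows "norm (T x) = 1"
proof -
  have "\<forall>f\<in>functionals. f x \<le> 1"
    using assms(3,4) by (auto elim!: functionals_cases simp: abs_le_iff)
  then show ?thesis using assms(1,2) functional_le_norm[of f x] unit[of x] by force
qed

lemma orthogonalI:
  assumes "f \<in> functionals" "f x = norm (T x)" "0 \<le> f y"
    and "g \<in> functionals" "g x = norm (T x)" "g y \<le> 0"
  shows "T x \<bottom>\<^sub>B T y"
  using assms unfolding orthogonal_iff maximizes_iff by blast

lemma orthogonalD:
  assumes "T x \<bottom>\<^sub>B T y"
  obtains f where "f \<in> functionals" "f x = norm (T x)" "f y \<le> 0"
  using assms unfolding orthogonal_iff maximizes_iff by blast

lemma orthogonalD':
  assumes "T x \<bottom>\<^sub>B T y"
  obtains f where "f \<in> functionals" "f x = norm (T x)" "0 \<le> f y"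
  using assms unfolding orthogonal_iff maximizes_iff by blast

section \<open>Facet centroids as the left-symmetric points\<close>

lemma quarter_turn: "of_int (2 * (k + int n) + 1) * \<delta> = of_int (2 * k + 1) * \<delta> + pi / 2"
  using n_\<delta> by (simp add: algebra_simps)

lemma side_side_centre: "side i (side_centre k) = cos (2 * pi * of_int (i - k) / real (4 * n))"
proof -
  have "of_int (2 * i + 1) * \<delta> - of_int (2 * k + 1) * \<delta> = 2 * of_int (i - k) * \<delta>"
    by (simp add: algebra_simps)
  also have "\<dots> = 2 * pi * of_int (i - k) / real (4 * n)"
    using n by (simp add: \<delta>_def field_simps)
  finally have "of_int (2 * i + 1) * \<delta> - of_int (2 * k + 1) * \<delta> = 2 * pi * of_int (i - k) / real (4 * n)" .
  then show ?thesis
    unfolding side_def side_centre_def linear_scale[OF linear_radial] radial_cylinder_point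
    using sin_cos_\<delta>_pos(1) by simp
qed

text \<open>Indices are determined only modulo \<open>4 * n\<close>, so uniqueness is stated for the
  functionals.\<close>

lemma side_side_centre_eq_1:
  assumes "side i (side_centre k) = 1" shows "side i = side k"
proof -
  obtain q where "2 * pi * of_int (i - k) / real (4 * n) = of_int q * 2 * pi"
    using assms unfolding side_side_centre cos_one_2pi_int by (auto simp: mult_ac)
  then have "2 * pi * (of_int (i - k) / real (4 * n)) = 2 * pi * of_int q" by simp
  then have "of_int (i - k) / real (4 * n) = of_int q" by (simp only: mult_cancel_left) simp
  then have "of_int (i - k) = real (4 * n) * of_int q" using n by (simp add: field_simps)
  then have "real_of_int (i - k) = real_of_int (int (4 * n) * q)" by simp
  then have "i = k + int (4 * n) * q" unfolding of_int_eq_iff by simp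
  then show ?thesis by (simp only: side_periodic)
qed

lemma side_side_centre_quarter: "side (k + int n) (side_centre k) = 0" "side k (side_centre (k + int n)) = 0"
proof -
  have "2 * pi * real n / real (4 * n) = pi / 2" using n by (simp add: field_simps)
  then show "side (k + int n) (side_centre k) = 0" "side k (side_centre (k + int n)) = 0"
    using n by (simp_all add: side_side_centre)
qed

lemma side_centre_nth3 [simp]: "side_centre k $ 3 = 0"
  by (simp add: side_centre_def)

lemma norm_side_centre: "norm (T (side_centre k)) = 1"
  by (rule norm_eq_1I[of "side k"]) (simp_all add: side_side_centre)

text \<open>The centroid of a vertical facet is a smooth point of the unit sphere: orthogonality to
  \<open>y\<close> then means \<open>side k y = 0\<close>.\<close>

lemma maximizes_side_centre:
  assumes "f \<in> functionals" "f (side_centre k) = norm (T (side_centre k))"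
  shows "f = side k"
  using assms by (cases rule: functionals_cases) (auto intro: side_side_centre_eq_1 simp: norm_side_centre)

text \<open>The horizontal part of \<open>x\<close> is parallel to facet \<open>k\<close>, so every
  side functional at \<open>x\<close> is a sine times the one a quarter turn further.\<close>

lemma side_rotate:
  assumes "side k x = 0"
  shows "side i x \<le> \<bar>side (k + int n) x\<bar>"
proof -
  define u where "u = of_int (2 * k + 1) * \<delta>"
  let ?t = "of_int (2 * i + 1) * \<delta>"
  have "radial u x = 0"
    using assms sin_cos_\<delta>_pos(1) by (simp add: side_def u_def)
  then have "radial ?t x = sin (?t - u) * radial (u + pi / 2) x"
    using radial_rotate[of ?t x u] by simp
  then have "side i x = sin (?t - u) * side (k + int n) x"
    unfolding side_def quarter_turn u_def by simp
  then have "\<bar>side i x\<bar> \<le> \<bar>side (k + int n) x\<bar>"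
    unfolding abs_mult by (simp add: abs_mult mult_left_le_one_le)
  then show ?thesis by linarith
qed

lemma left_symmetric_side_centre: "left_symmetric_point (T (side_centre k))"
  unfolding left_symmetric_point_def
proof (intro allI impI)
  let ?c = "side_centre k"
  fix w assume "T ?c \<bottom>\<^sub>B w"
  obtain y where w: "w = T y"
    using prism by (metis bij_pointE unit_sphere_is_prism_def)
  have perp: "T ?c \<bottom>\<^sub>B T y" using \<open>T ?c \<bottom>\<^sub>B w\<close> w by simp
  have "side k y \<le> 0" "0 \<le> side k y"
    using orthogonalD[OF perp] orthogonalD'[OF perp] maximizes_side_centre by metis+
  then have y: "side i y \<le> \<bar>side (k + int n) y\<bar>" for i by (intro side_rotate) simp
  obtain f where f: "maximizes functionals y f" using ex_maximizes by blast
  have neg: "side (k + int n + int (2 * n)) z = - side (k + int n) z" for z by (rule side_opposite)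
  \<comment> \<open>A norming functional of \<open>y\<close> that vanishes at the centroid serves as
    the nonnegative and as the nonpositive one at once. It is a height functional, or side
    \<open>k + n\<close> or its opposite according to sign.\<close>
  have "\<exists>g\<in>functionals. g y = norm (T y) \<and> g ?c = 0"
  proof -
    have "f \<in> functionals" and fy: "f y = norm (T y)" using f by (auto simp: maximizes_iff)
    from this(1) show ?thesis
    proof (cases rule: functionals_cases)
      case (side i)
      have "f y \<le> \<bar>side (k + int n) y\<bar>" using y side by simp
      moreover have "side (k + int n) y \<le> norm (T y)" "- side (k + int n) y \<le> norm (T y)"
        using functional_le_norm[of "side (k + int n)" y]
          functional_le_norm[of "side (k + int n + int (2 * n))" y] neg by simp_all
      ultimately have "side (k + int n) y = norm (T y) \<or> side (k + int n + int (2 * n)) y = norm (T y)"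
        using fy neg[of y] by linarith
      then show ?thesis
        using neg[of ?c] side_side_centre_quarter(1)[of k] in_functionals(1) by (metis neg_equal_zero minus_zero)
    next
      case up then show ?thesis using fy by (intro bexI[of _ f]) auto
    next
      case down then show ?thesis using fy by (intro bexI[of _ f]) auto
    qed
  qed
  then show "w \<bottom>\<^sub>B T ?c" unfolding w using orthogonalI by (metis order_refl)
qed

lemma base_centre_nth [simp]: "base_centre s $ 1 = 0" "base_centre s $ 2 = 0" "base_centre s $ 3 = s"
  by (simp_all add: base_centre_def)

lemma side_base_centre [simp]: "side i (base_centre s) = 0"
  by (simp add: side_def radial_def)

text \<open>The only functional norming this point is the signed height, so a vector orthogonal to
  it is horizontal. Such a vector is normed by a side functional, and these vanish on the
  axis.\<close>

lemma left_symmetric_base_centre: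
  assumes s: "s \<in> {1, -1}"
  shows "left_symmetric_point (T (base_centre s))"
  unfolding left_symmetric_point_def
proof (intro allI impI)
  let ?c = "base_centre s"
  fix w assume "T ?c \<bottom>\<^sub>B w"
  obtain y where w: "w = T y"
    using prism by (metis bij_pointE unit_sphere_is_prism_def)
  have perp: "T ?c \<bottom>\<^sub>B T y" using \<open>T ?c \<bottom>\<^sub>B w\<close> w by simp
  have norm: "norm (T ?c) = 1"
    using s by (intro norm_eq_1I[of "\<lambda>x. s * x $ 3"]) auto
  have f: "f y = s * y $ 3" if "f \<in> functionals" "f ?c = norm (T ?c)" for f
    using that s by (cases rule: functionals_cases) (auto simp: norm)
  have "s * y $ 3 \<le> 0" "0 \<le> s * y $ 3"
    using orthogonalD[OF perp] orthogonalD'[OF perp] f by metis+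
  then have y3: "y $ 3 = 0" using s by auto
  obtain k \<alpha> \<beta> where sec: "sector k \<alpha> \<beta> y" by (rule sector_exists)
  have "side k y = norm (T y)"
    using norm_sector[OF sec] sector_side_self[OF sec] y3 sec by (simp add: sector_def)
  then show "w \<bottom>\<^sub>B T ?c" unfolding w by (intro orthogonalI[of "side k" _ _ "side k"]) simp_all
qed

lemma left_symmetric_imp_centre:
  assumes sym: "left_symmetric_point (T p)" and norm: "norm (T p) = 1"
  shows "(\<exists>k. p = side_centre k) \<or> (\<exists>s\<in>{1, -1}. p = base_centre s)"
proof -
  obtain k \<alpha> \<beta> where sec: "sector k \<alpha> \<beta> p" by (rule sector_exists)
  have ab: "0 \<le> \<alpha>" "0 \<le> \<beta>" using sec by (auto simp: sector_def)
  have max: "max (\<alpha> + \<beta>) \<bar>p $ 3\<bar> = 1" using norm norm_sector[OF sec] by simp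
  have reverse: "T y \<bottom>\<^sub>B T p" if "T p \<bottom>\<^sub>B T y" for y
    using sym that by (simp add: left_symmetric_point_def)
  consider "\<bar>p $ 3\<bar> = 1" "\<alpha> + \<beta> > 0" | "\<bar>p $ 3\<bar> = 1" "\<alpha> + \<beta> = 0" | "\<alpha> + \<beta> = 1" "p $ 3 \<noteq> 0" "\<bar>p $ 3\<bar> < 1"
    | "\<alpha> + \<beta> = 1" "p $ 3 = 0"
    using max ab by (fastforce simp: max_def split: if_splits)
  then show ?thesis
  proof cases
    case 1
    \<comment> \<open>On a base face off the axis, the horizontal part of \<open>p\<close> is the
      witness: the height functional norming \<open>p\<close> vanishes on it, whereas only sides
      norm it, with the same positive value at \<open>p\<close>.\<close>
    define y :: "real^3" where "y = vector [p $ 1, p $ 2, 0]"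
    have side: "side i y = side i p" for i by (simp add: side_def radial_def y_def)
    define s where "s = sgn (p $ 3)"
    have s: "s \<in> {1, -1}" "s * p $ 3 = 1" using 1 by (auto simp: s_def sgn_if abs_if split: if_splits)
    have "T p \<bottom>\<^sub>B T y"
      using s by (intro orthogonalI[of "\<lambda>x. s * x $ 3" _ _ "\<lambda>x. s * x $ 3"]) (simp_all add: norm y_def)
    then obtain f where f: "f \<in> functionals" "f y = norm (T y)" "f p \<le> 0"
      using orthogonalD[OF reverse] by blast
    have "0 < norm (T y)"
      using functional_le_norm[OF in_functionals(1), of k y] sector_side_self[OF sec] 1(2) side[of k] by linarith
    with f(1) f(2,3) show ?thesis
      by (cases rule: functionals_cases) (simp_all add: side, simp_all add: y_def)
  next
    case 2
    then have "\<alpha> = 0" "\<beta> = 0" using ab by auto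
    then have "p = base_centre (p $ 3)" using sec by (simp add: vec3_eq_iff sector_def)
    moreover have "p $ 3 \<in> {1, -1}" using 2 by (auto simp: abs_if split: if_splits)
    ultimately show ?thesis by blast
  next
    case 3
    \<comment> \<open>The vertical part of \<open>p\<close> is the witness: \<open>side k\<close>
      vanishes on it, but the height functional norming it is positive at \<open>p\<close>.\<close>
    let ?y = "base_centre (p $ 3)"
    have "T p \<bottom>\<^sub>B T ?y"
      using sector_side_self[OF sec] 3 by (intro orthogonalI[of "side k" _ _ "side k"]) (simp_all add: norm)
    then obtain f where f: "f \<in> functionals" "f ?y = norm (T ?y)" "f p \<le> 0"
      using orthogonalD[OF reverse] by blast
    have "0 < norm (T ?y)"
      using functional_le_norm[of "\<lambda>x. x $ 3" ?y] functional_le_norm[of "\<lambda>x. - x $ 3" ?y] 3(2) by auto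
    with f(1) f(2,3) show ?thesis
      by (cases rule: functionals_cases) simp_all
  next
    case 4
    \<comment> \<open>\<open>side k\<close> norms \<open>p\<close> and vanishes at this smooth
      point. The reversed orthogonality kills the component of \<open>p\<close> along the edge,
      which leaves only the centre of the facet.\<close>
    let ?y = "side_centre (k + int n)"
    have "T p \<bottom>\<^sub>B T ?y"
      using sector_side_self[OF sec] 4
      by (intro orthogonalI[of "side k" _ _ "side k"]) (simp_all add: norm side_side_centre_quarter)
    then have perp: "T ?y \<bottom>\<^sub>B T p" by (rule reverse)
    have "side (k + int n) p \<le> 0" "0 \<le> side (k + int n) p"
      using orthogonalD[OF perp] orthogonalD'[OF perp] maximizes_side_centre by metis+
    then have "radial (of_int (2 * k + 1) * \<delta> + pi / 2) p = 0"
      using sin_cos_\<delta>_pos(1) unfolding side_def quarter_turn by (simp add: field_simps)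
    moreover have "radial (of_int (2 * k + 1) * \<delta>) p = cos \<delta>"
      using sector_side_self[OF sec] 4(1) sin_cos_\<delta>_pos(1) by (simp add: side_def)
    ultimately have "p = side_centre k"
      using planar_coordinates[of p "of_int (2 * k + 1) * \<delta>"] 4(2)
      by (simp add: vec3_eq_iff side_centre_def)
    then show ?thesis by blast
  qed
qed

section \<open>Vertices as the right-symmetric points\<close>

lemma norm_vertex: "s \<in> {1, -1} \<Longrightarrow> norm (T (vertex k s)) = 1"
  by (rule norm_eq_1I[of "side k"]) (auto simp: side_vertex_le)

text \<open>If side \<open>i\<close> attains its maximum at \<open>y\<close>, then \<open>y\<close> lies in the cone over that side, and by
  \<open>sin_add_mult_cos\<close> the normal of side \<open>i\<close> is a positive combination of the two rays obtained by
  rotating \<open>y\<close> by \<open>\<delta>\<close> either way. The positivity assumptions say that these two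
  rays form acute angles with the vertex.\<close>

lemma pos_at_vertex:
  assumes s: "s \<in> {1, -1}"
    and pos: "0 < side j y" "0 < side (j - 1) y" "0 < s * y $ 3"
    and f: "maximizes functionals y f"
  shows "0 < f (vertex j s)"
proof -
  have "f \<in> functionals" and max: "\<And>g. g \<in> functionals \<Longrightarrow> g y \<le> f y"
    using f by (auto simp: maximizes_def)
  have fpos: "0 < f y" using max[of "side j"] pos(1) by simp
  from \<open>f \<in> functionals\<close> show ?thesis
  proof (cases rule: functionals_cases)
    case (side i)
    obtain r t where r: "0 \<le> r" and y: "y $ 1 = r * cos t" "y $ 2 = r * sin t"
      using ex_polar_coordinates by blast
    have rad: "radial u y = r * cos (u - t)" for u
      by (simp add: radial_def y cos_diff algebra_simps)
    have "r \<noteq> 0" using pos(1) by (auto simp: side_def rad)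
    then have r: "r > 0" using r by simp
    \<comment> \<open>Angles from the direction \<open>t\<close> of \<open>y\<close> to the two ends
      of edge \<open>i\<close>; \<open>\<phi>\<close> is the angle from vertex \<open>j\<close> to
      the normal of side \<open>i\<close>. As \<open>t\<close> and \<open>i\<close> are fixed only
      up to full turns, \<open>a\<close> and \<open>b\<close> are controlled through the signs of
      their sines.\<close>
    define a where "a = of_int (2 * i + 2) * \<delta> - t"
    define b where "b = t - of_int (2 * i) * \<delta>"
    define \<phi> where "\<phi> = of_int (2 * (i - j) + 1) * \<delta>"
    have ab: "a + b = 2 * \<delta>" by (simp add: a_def b_def algebra_simps)
    have le: "radial (of_int (2 * i' + 1) * \<delta>) y \<le> radial (of_int (2 * i + 1) * \<delta>) y" for i'
      using max[of "side i'"] sin_cos_\<delta>_pos(1) by (simp add: side side_def divide_le_cancel)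
    \<comment> \<open>Side \<open>i\<close> is at least its neighbour \<open>i + 1\<close> at
      \<open>y\<close>, which amounts to \<open>sin a * sin \<delta> \<ge> 0\<close>; the neighbour
      \<open>i - 1\<close> does the same for \<open>b\<close>.\<close>
    have "cos (a + \<delta>) \<le> cos (a - \<delta>)"
    proof -
      have "of_int (2 * (i + 1) + 1) * \<delta> - t = a + \<delta>" "of_int (2 * i + 1) * \<delta> - t = a - \<delta>"
        by (simp_all add: a_def algebra_simps)
      then show ?thesis using le[of "i + 1"] r unfolding rad by simp
    qed
    then have a: "0 \<le> sin a"
      using sin_cos_\<delta>_pos(2) by (simp add: cos_add cos_diff zero_le_mult_iff)
    have "cos (b + \<delta>) \<le> cos (b - \<delta>)"
    proof -
      have "of_int (2 * (i - 1) + 1) * \<delta> - t = - (b + \<delta>)" "of_int (2 * i + 1) * \<delta> - t = - (b - \<delta>)"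
        by (simp_all add: b_def algebra_simps)
      then show ?thesis using le[of "i - 1"] r unfolding rad by (simp only: cos_minus) simp
    qed
    then have b: "0 \<le> sin b"
      using sin_cos_\<delta>_pos(2) by (simp add: cos_add cos_diff zero_le_mult_iff)
    \<comment> \<open>\<open>\<phi> + b\<close> and \<open>\<phi> - a\<close> are the angles from
      vertex \<open>j\<close> to the directions \<open>t + \<delta>\<close> and
      \<open>t - \<delta>\<close>; positivity of the two sides meeting at the vertex makes both
      acute.\<close>
    have cos: "0 < cos (\<phi> + b)" "0 < cos (\<phi> - a)"
    proof -
      have "of_int (2 * (j - 1) + 1) * \<delta> - t = - (\<phi> + b)" "of_int (2 * j + 1) * \<delta> - t = - (\<phi> - a)"
        by (simp_all add: \<phi>_def a_def b_def algebra_simps)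
      then have "cos (of_int (2 * (j - 1) + 1) * \<delta> - t) = cos (\<phi> + b)" "cos (of_int (2 * j + 1) * \<delta> - t) = cos (\<phi> - a)"
        by (simp_all only: cos_minus)
      then show "0 < cos (\<phi> + b)" "0 < cos (\<phi> - a)"
        using pos(1,2) r sin_cos_\<delta>_pos(1) unfolding side_def rad by (simp_all add: zero_less_divide_iff zero_less_mult_iff)
    qed
    have "sin a \<noteq> 0 \<or> sin b \<noteq> 0"
    proof (rule ccontr)
      assume "\<not> (sin a \<noteq> 0 \<or> sin b \<noteq> 0)"
      then have "sin (a + b) = 0" by (simp add: sin_add)
      then show False using sin_cos_\<delta>_pos(3) by (simp add: ab)
    qed
    then have "0 < sin b * cos (\<phi> - a) + sin a * cos (\<phi> + b)"
      using a b cos by (smt (verit) mult_pos_pos mult_nonneg_nonneg)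
    also have "\<dots> = sin (b + a) * cos \<phi>" using sin_add_mult_cos[of b a \<phi>] by simp
    finally have "0 < cos \<phi>"
      using sin_cos_\<delta>_pos(3) by (simp add: add.commute[of b a] ab zero_less_mult_iff)
    then show ?thesis using sin_cos_\<delta>_pos(1) by (simp only: side side_vertex \<phi>_def) simp
  qed (use fpos pos(3) s in auto)
qed

lemma right_symmetric_vertex:
  assumes s: "s \<in> {1, -1}"
  shows "right_symmetric_point (T (vertex j s))"
  unfolding right_symmetric_point_def
proof (intro allI impI)
  let ?v = "vertex j s"
  fix w assume "w \<bottom>\<^sub>B T ?v"
  obtain y where w: "w = T y"
    using prism by (metis bij_pointE unit_sphere_is_prism_def)
  have perp: "T y \<bottom>\<^sub>B T ?v" using \<open>w \<bottom>\<^sub>B T ?v\<close> w by simp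
  have no: False if "0 < side j x" "0 < side (j - 1) x" "0 < s * x $ 3" "T x \<bottom>\<^sub>B T ?v" for x
    using orthogonal_imp_maximizes_le[OF that(4)] pos_at_vertex[OF s that(1-3)] by force
  \<comment> \<open>Applied to \<open>- y\<close>, the same exclusion yields a facet functional at
    the vertex that is nonnegative at \<open>y\<close>.\<close>
  have perp': "T (- y) \<bottom>\<^sub>B T ?v"
    using birkhoff_orthogonal_minus_left[OF perp] by (simp add: linear_neg[OF T])
  let ?F = "{side j, side (j - 1), \<lambda>x. s * x $ 3}"
  have F: "f \<in> functionals \<and> f ?v = norm (T ?v)" if "f \<in> ?F" for f
    using that s side_vertex_self(2)[of "j - 1" s] by (auto simp: norm_vertex)
  have "\<exists>f\<in>?F. f y \<le> 0" using no[OF _ _ _ perp] by force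
  moreover have "\<exists>f\<in>?F. 0 \<le> f y" using no[OF _ _ _ perp'] by (force simp: side_minus)
  ultimately show "T ?v \<bottom>\<^sub>B w" unfolding w using F orthogonalI by metis
qed

lemma right_symmetric_imp_vertex:
  assumes sym: "right_symmetric_point (T p)" and norm: "norm (T p) = 1"
  shows "\<exists>k s. s \<in> {1, -1} \<and> p = vertex k s"
proof -
  obtain k \<alpha> \<beta> where sec: "sector k \<alpha> \<beta> p" by (rule sector_exists)
  have ab: "0 \<le> \<alpha>" "0 \<le> \<beta>" using sec by (auto simp: sector_def)
  have max: "max (\<alpha> + \<beta>) \<bar>p $ 3\<bar> = 1" using norm norm_sector[OF sec] by simp
  have reverse: "T p \<bottom>\<^sub>B T y" if "T y \<bottom>\<^sub>B T p" for y
    using sym that by (simp add: right_symmetric_point_def)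
  have side_p: "side k p = \<alpha> + \<beta>" by (rule sector_side_self[OF sec])
  show ?thesis
  proof (cases "\<bar>p $ 3\<bar> < 1")
    case True
    then have one: "\<alpha> + \<beta> = 1" using max by (auto simp: max_def split: if_splits)
    \<comment> \<open>Keeping the horizontal part of \<open>p\<close> and moving to the base on the
      other side of height 0 gives \<open>y\<close>. Its height functional is nonpositive at
      \<open>p\<close>, while \<open>p\<close> is normed by sides alone, which do not distinguish
      the two.\<close>
    define s :: real where "s = (if p $ 3 \<ge> 0 then -1 else 1)"
    have s: "s \<in> {1, -1}" "s * p $ 3 \<le> 0" by (auto simp: s_def)
    define y :: "real^3" where "y = vector [p $ 1, p $ 2, s]"
    have side: "side i y = side i p" for i by (simp add: side_def radial_def y_def)
    have y3: "y $ 3 = s" by (simp add: y_def)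
    have ny: "norm (T y) = 1"
      using sector_side_le[OF sec] one s by (intro norm_eq_1I[of "side k"]) (auto simp: side side_p y3)
    have "T y \<bottom>\<^sub>B T p"
      using s one by (intro orthogonalI[of "side k" _ _ "\<lambda>x. s * x $ 3"]) (auto simp: ny side side_p y3)
    then obtain f where f: "f \<in> functionals" "f p = 1" "f y \<le> 0"
      using orthogonalD[OF reverse] norm by metis
    from f(1) f(2,3) True show ?thesis
      by (cases rule: functionals_cases) (simp_all add: side)
  next
    case False
    then have s: "p $ 3 \<in> {1, -1}" "p $ 3 * p $ 3 = 1" and le: "\<alpha> + \<beta> \<le> 1"
      using max by (auto simp: max_def abs_if split: if_splits)
    define s where "s = p $ 3"
    note s = s[folded s_def]
    \<comment> \<open>The vertex is orthogonal to \<open>p\<close>, since its height functional is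
      positive and side \<open>i\<close> nonpositive there; right symmetry reverses this. A
      contradiction then needs a vertex at which all functionals norming \<open>p\<close> are
      positive.\<close>
    have perp: "T p \<bottom>\<^sub>B T (vertex l s)" if "side i (vertex l s) = 1" "side i p \<le> 0" for i l
      using that s by (intro reverse orthogonalI[of "\<lambda>x. s * x $ 3" _ _ "side i"])
        (auto simp: norm_vertex s_def[symmetric])
    have no_height: False if "f \<in> functionals" "f p = 1" "f (vertex l s) \<le> 0" "\<And>i. f = side i \<Longrightarrow> False" for f l
      using that(1)
      by (cases rule: functionals_cases) (use that(2-) s in \<open>auto simp: s_def[symmetric]\<close>)
    show ?thesis
    proof (cases "\<alpha> + \<beta> < 1")
      case True
      \<comment> \<open>In the relative interior of a base face only the height functional norms
        \<open>p\<close>, so a vertex on the opposite side will do.\<close>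
      have "side (k + int (2 * n)) p \<le> 0" unfolding side_opposite side_p using ab by simp
      then have "T p \<bottom>\<^sub>B T (vertex (k + int (2 * n)) s)"
        by (rule perp[OF side_vertex_self(1)])
      then obtain f where f: "f \<in> functionals" "f p = 1" "f (vertex (k + int (2 * n)) s) \<le> 0"
        using orthogonalD norm by metis
      have "side i p \<noteq> 1" for i using sector_side_le[OF sec, of i] True by simp
      then show ?thesis using no_height[OF f] f(2) by metis
    next
      case False
      then have one: "\<alpha> + \<beta> = 1" using le by simp
      show ?thesis
      proof (cases "\<alpha> = 0 \<or> \<beta> = 0")
        case True
        then have "p = vertex (k + 1) s \<or> p = vertex k s"
          using one sec by (auto simp: vec3_eq_iff sector_def s_def vertex_def)
        then show ?thesis using s(1) by blast
      next
        case False
        then have pos: "0 < \<alpha>" "0 < \<beta>" using ab by auto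
        \<comment> \<open>\<open>side i p\<close> is a combination, with positive weights of sum 1,
          of values at most 1 at both ends of edge \<open>k\<close>. Both must equal 1, and distinct
          edges cannot share both ends because \<open>4 * n > 2\<close>.\<close>
        have uniq: "side i = side k" if "side i p = 1" for i
        proof -
          have "\<alpha> * (1 - side i (vertex k 0)) + \<beta> * (1 - side i (vertex (k + 1) 0)) = 0"
            using that one unfolding sector_side[OF sec] by (simp add: algebra_simps)
          moreover have "0 \<le> \<alpha> * (1 - side i (vertex k 0))" "0 \<le> \<beta> * (1 - side i (vertex (k + 1) 0))"
            using ab side_vertex_le by (auto intro!: mult_nonneg_nonneg)
          ultimately have "\<alpha> * (1 - side i (vertex k 0)) = 0" "\<beta> * (1 - side i (vertex (k + 1) 0)) = 0"
            by linarith+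
          then have "side i (vertex k 0) = 1" "side i (vertex (k + 1) 0) = 1" using pos by auto
          then have d: "int (4 * n) dvd i - k \<or> int (4 * n) dvd i + 1 - k"
            "int (4 * n) dvd i - (k + 1) \<or> int (4 * n) dvd i + 1 - (k + 1)"
            using side_vertex_eq_1 unfolding mod_eq_dvd_iff by blast+
          have "int (4 * n) dvd i - k"
          proof (rule ccontr)
            assume "\<not> int (4 * n) dvd i - k"
            moreover have "i + 1 - (k + 1) = i - k" by simp
            ultimately have "int (4 * n) dvd i + 1 - k" "int (4 * n) dvd i - (k + 1)" using d by metis+
            then have "int (4 * n) dvd (i + 1 - k) - (i - (k + 1))" by (rule dvd_diff)
            then have "int (4 * n) dvd 2" by simp
            then have "int (4 * n) \<le> 2" by (rule zdvd_imp_le) simp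
            then show False using n by simp
          qed
          then have "i mod int (4 * n) = k mod int (4 * n)" by (simp only: mod_eq_dvd_iff)
          then show ?thesis by (metis side_mod)
        qed
        have contra: False if perp_l: "T p \<bottom>\<^sub>B T (vertex l s)" and pos_l: "0 < side k (vertex l s)" for l
        proof -
          obtain f where f: "f \<in> functionals" "f p = 1" "f (vertex l s) \<le> 0"
            using orthogonalD[OF perp_l] norm by metis
          have "f \<noteq> side i" for i using uniq[of i] f pos_l by auto
          then show False using no_height[OF f] by blast
        qed
        \<comment> \<open>The two candidates lie \<open>\<delta>\<close> short of a quarter turn
          from the normal of side \<open>k\<close>, one on each side of it, so \<open>side k\<close>
          is positive at both. They belong to sides \<open>k + n\<close> and
          \<open>k + 3 * n\<close>, which are opposite; hence one of these sides is nonpositive at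
          \<open>p\<close>.\<close>
        have quarter: "of_int (2 * (k - (k + int n)) + 1) * \<delta> = - (pi / 2 - \<delta>)"
          "of_int (2 * (k - (k + int n + int (2 * n) + 1)) + 1) * \<delta> = - (pi + (pi / 2 + \<delta>))"
          using n_\<delta> by (simp_all add: algebra_simps)
        show ?thesis
        proof (cases "side (k + int n) p \<le> 0")
          case True
          have "T p \<bottom>\<^sub>B T (vertex (k + int n) s)" by (rule perp[OF side_vertex_self(1) True])
          moreover have "0 < side k (vertex (k + int n) s)"
            unfolding side_vertex quarter cos_minus using sin_cos_\<delta>_pos by (simp add: cos_diff)
          ultimately show ?thesis using contra by blast
        next
          case False
          then have "side (k + int n + int (2 * n)) p \<le> 0" unfolding side_opposite by simp
          then have "T p \<bottom>\<^sub>B T (vertex (k + int n + int (2 * n) + 1) s)" by (rule perp[OF side_vertex_self(2)])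
          moreover have "0 < side k (vertex (k + int n + int (2 * n) + 1) s)"
            unfolding side_vertex quarter cos_minus cos_periodic_pi2 using sin_cos_\<delta>_pos
            by (simp add: cos_add)
          ultimately show ?thesis using contra by blast
        qed
      qed
    qed
  qed
qed

end

theorem theorem2p8:
  fixes n :: nat and T :: "real^3 \<Rightarrow> 'z::banach" and z :: 'z
  assumes "n \<ge> 1"
    and "dim (UNIV :: 'z set) = 3"
    and "polyhedral_space TYPE('z)"
    and "unit_sphere_is_prism (4 * n) T"
    and "z \<in> sphere 0 1"
  shows "(left_symmetric_point z \<longleftrightarrow>
            (\<exists>F. vertical_facet (4 * n) F \<and> is_centroid (T ` F) z) \<or>
            (\<exists>F. horizontal_facet (4 * n) F \<and> is_centroid (T ` F) z)) \<and>
         (right_symmetric_point z \<longleftrightarrow> z extreme_point_of cball 0 1)"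
proof -
  interpret prism_norm n T using assms(1,4) by unfold_locales
  have T: "linear T" "bij T" "cball 0 1 = T ` right_prism (4 * n)"
    using assms(4) by (auto simp: unit_sphere_is_prism_def)
  obtain p where z: "z = T p" using T(2) by (metis bij_pointE)
  have norm: "norm (T p) = 1" using assms(5) z by simp
  have "z extreme_point_of cball 0 1 \<longleftrightarrow> p extreme_point_of right_prism (4 * n)"
    using face_of_linear_image[OF T(1) bij_is_inj[OF T(2)], of "{p}" "right_prism (4 * n)"]
    unfolding T(3) z by (simp add: face_of_singleton)
  moreover have "right_symmetric_point z \<longleftrightarrow> (\<exists>k s. s \<in> {1, -1} \<and> p = vertex k s)"
    using right_symmetric_vertex right_symmetric_imp_vertex norm unfolding z by blast
  moreover have "left_symmetric_point z \<longleftrightarrow> (\<exists>k. p = side_centre k) \<or> (\<exists>s\<in>{1, -1}. p = base_centre s)"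
    using left_symmetric_side_centre left_symmetric_base_centre left_symmetric_imp_centre norm
    unfolding z by blast
  ultimately show ?thesis
    unfolding extreme_point_right_prism_iff z is_centroid_linear_image[OF T(1,2)]
      vertical_centroid_iff horizontal_centroid_iff by simp
qed

end
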